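(* Let $n\geq 3$ and $m\geq 2$. Let $(M^{n},g)$ be a compact Riemannian manifold, let $(N^{m},\tilde g)$ be a Ricci-flat semi-Riemannian manifold, and let $f:M\to(0,+\infty)$ be a smooth function. Suppose that the warped product $(\widehat M^{n+m},\hat g)=(M^{n},g)\times_f(N^{m},\tilde g)$ is an Einstein semi-Riemannian manifold which is not Ricci-flat, i.e. $\widehat{Ric}=\lambda\hat g$ for some constant $\lambda\neq 0$. Then $\widehat M$ is a product manifold, i.e. $f$ is trivial (constant).
   Context: The warped product $(M^{n},g)\times_f(N^{m},\tilde g)$ is the product manifold $M\times N$ endowed with the metric $\hat g=g+f^{2}\tilde g$; $M$ is the base, $N$ the fiber and $f$ the warping function. $\widehat{Ric}$ is the Ricci tensor of $\hat g$. Manifolds are connected and without boundary. *)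

theory Defs
  imports "HOL-Analysis.Analysis"
begin

section \<open>Smooth maps between open subsets of Euclidean spaces\<close>

text \<open>
  The set \<open>S\<close> is meant to be open. In finite dimensions \<open>Ck_on k S h\<close> says that all
  iterated partial derivatives of \<open>h\<close> up to order \<open>k\<close> exist and are continuous on \<open>S\<close>.
\<close>

primrec Ck_on :: "nat \<Rightarrow> 'e::real_normed_vector set \<Rightarrow> ('e \<Rightarrow> 'f::real_normed_vector) \<Rightarrow> bool" where
  "Ck_on 0 S h \<longleftrightarrow> continuous_on S h"
| "Ck_on (Suc k) S h \<longleftrightarrow>
     (\<forall>x\<in>S. h differentiable (at x)) \<and> (\<forall>v. Ck_on k S (\<lambda>x. frechet_derivative h (at x) v))"

definition smooth_on :: "'e::real_normed_vector set \<Rightarrow> ('e \<Rightarrow> 'f::real_normed_vector) \<Rightarrow> bool" where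
  "smooth_on S h \<longleftrightarrow> (\<forall>k. Ck_on k S h)"


section \<open>Smooth manifolds\<close>

text \<open>
  A chart is a pair of its domain and its coordinate map; the values of the coordinate map outside
  the domain are irrelevant. The dimension of a manifold modelled on \<open>'e\<close> is \<open>DIM('e)\<close>.
  An atlas need not be maximal.
\<close>

type_synonym ('a, 'e) chart = "'a set \<times> ('a \<Rightarrow> 'e)"

abbreviation chart_dom :: "('a, 'e) chart \<Rightarrow> 'a set" where
  "chart_dom c \<equiv> fst c"

abbreviation chart_map :: "('a, 'e) chart \<Rightarrow> 'a \<Rightarrow> 'e" where
  "chart_map c \<equiv> snd c"

definition chart_range :: "('a, 'e) chart \<Rightarrow> 'e set" where
  "chart_range c = chart_map c ` chart_dom c"

definition chart_inv :: "('a, 'e) chart \<Rightarrow> 'e \<Rightarrow> 'a" where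
  "chart_inv c = inv_into (chart_dom c) (chart_map c)"

definition smooth_atlas :: "'a topology \<Rightarrow> ('a, 'e::euclidean_space) chart set \<Rightarrow> bool" where
  "smooth_atlas X A \<longleftrightarrow>
     (\<forall>c\<in>A. openin X (chart_dom c) \<and> open (chart_range c) \<and>
        homeomorphic_map (subtopology X (chart_dom c)) (top_of_set (chart_range c)) (chart_map c)) \<and>
     (\<Union>c\<in>A. chart_dom c) = topspace X \<and>
     (\<forall>c\<in>A. \<forall>d\<in>A.
        smooth_on (chart_map c ` (chart_dom c \<inter> chart_dom d)) (chart_map d \<circ> chart_inv c))"

text \<open>
  Manifolds are connected, and nonempty by convention (the library's \<open>connected_space\<close> holds of
  the empty space). They have no boundary, since the charts map onto open sets.
\<close>

definition smooth_manifold :: "'a topology \<Rightarrow> ('a, 'e::euclidean_space) chart set \<Rightarrow> bool" where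
  "smooth_manifold X A \<longleftrightarrow>
     Hausdorff_space X \<and> second_countable X \<and> connected_space X \<and> topspace X \<noteq> {} \<and>
     smooth_atlas X A"

definition smooth_fun :: "('a, 'e::euclidean_space) chart set \<Rightarrow> ('a \<Rightarrow> real) \<Rightarrow> bool" where
  "smooth_fun A f \<longleftrightarrow> (\<forall>c\<in>A. smooth_on (chart_range c) (f \<circ> chart_inv c))"


section \<open>Tangent vectors and metrics\<close>

text \<open>
  A tangent vector at \<open>p\<close> is a derivation on the functions that are smooth near \<open>p\<close>. To make it a
  total functional it is set to \<open>0\<close> on all other functions. For a chart \<open>c\<close> around \<open>p\<close>, the map
  \<open>coord_vec c p\<close> is the isomorphism from \<open>'e\<close> onto the tangent space at \<open>p\<close> that sends the
  \<open>i\<close>-th basis vector to the coordinate vector \<open>\<partial>\<^sub>i\<close> of \<open>c\<close>.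
\<close>

type_synonym 'a tangent = "('a \<Rightarrow> real) \<Rightarrow> real"

definition smooth_near :: "('a, 'e::euclidean_space) chart \<Rightarrow> 'a \<Rightarrow> ('a \<Rightarrow> real) \<Rightarrow> bool" where
  "smooth_near c p h \<longleftrightarrow>
     (\<exists>W. open W \<and> chart_map c p \<in> W \<and> W \<subseteq> chart_range c \<and> smooth_on W (h \<circ> chart_inv c))"

definition coord_vec :: "('a, 'e::euclidean_space) chart \<Rightarrow> 'a \<Rightarrow> 'e \<Rightarrow> 'a tangent" where
  "coord_vec c p v = (\<lambda>h. if smooth_near c p h
     then frechet_derivative (h \<circ> chart_inv c) (at (chart_map c p)) v else 0)"

text \<open>The differential of a smooth map \<open>F\<close>, as a map on tangent vectors.\<close>

definition pushforward :: "('a \<Rightarrow> 'b) \<Rightarrow> 'a tangent \<Rightarrow> 'b tangent" where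
  "pushforward F u = (\<lambda>h. u (h \<circ> F))"

text \<open>A field of \<open>(0,2)\<close>-tensors, and its expression in the coordinates of a chart.\<close>

type_synonym 'a tensor2 = "'a \<Rightarrow> 'a tangent \<Rightarrow> 'a tangent \<Rightarrow> real"

definition coord_expr :: "'a tensor2 \<Rightarrow> ('a, 'e::euclidean_space) chart \<Rightarrow> 'e \<Rightarrow> 'e \<Rightarrow> 'e \<Rightarrow> real" where
  "coord_expr g c x v w = g (chart_inv c x) (coord_vec c (chart_inv c x) v) (coord_vec c (chart_inv c x) w)"

text \<open>
  Since manifolds are connected, the index of the nondegenerate form is automatically constant.
\<close>

definition semi_riemannian_metric ::
    "('a, 'e::euclidean_space) chart set \<Rightarrow> 'a tensor2 \<Rightarrow> bool" where
  "semi_riemannian_metric A g \<longleftrightarrow>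
     (\<forall>c\<in>A.
        (\<forall>v w. smooth_on (chart_range c) (\<lambda>x. coord_expr g c x v w)) \<and>
        (\<forall>x\<in>chart_range c.
           bilinear (coord_expr g c x) \<and>
           (\<forall>v w. coord_expr g c x v w = coord_expr g c x w v) \<and>
           (\<forall>v. (\<forall>w. coord_expr g c x v w = 0) \<longrightarrow> v = 0)))"

definition riemannian_metric ::
    "('a, 'e::euclidean_space) chart set \<Rightarrow> 'a tensor2 \<Rightarrow> bool" where
  "riemannian_metric A g \<longleftrightarrow>
     semi_riemannian_metric A g \<and>
     (\<forall>c\<in>A. \<forall>x\<in>chart_range c. \<forall>v. v \<noteq> 0 \<longrightarrow> 0 < coord_expr g c x v v)"


section \<open>Ricci curvature\<close>

text \<open>
  In this section \<open>G x v w\<close> is the coordinate expression of a metric. The vector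
  \<open>christoffel G x u v\<close> is the covariant derivative at \<open>x\<close>, in direction \<open>u\<close>, of the constant
  coordinate field \<open>v\<close>; it is given by the Koszul formula for the Levi-Civita connection, in which
  the brackets of constant coordinate fields vanish. With the \<open>i\<close>-th and \<open>j\<close>-th basis vectors as
  \<open>u\<close> and \<open>v\<close>, its components are the Christoffel symbols \<open>\<Gamma>\<^sup>k\<^sub>i\<^sub>j\<close>.
\<close>

definition christoffel :: "('e::euclidean_space \<Rightarrow> 'e \<Rightarrow> 'e \<Rightarrow> real) \<Rightarrow> 'e \<Rightarrow> 'e \<Rightarrow> 'e \<Rightarrow> 'e" where
  "christoffel G x u v = (THE z. \<forall>w. 2 * G x z w =
       frechet_derivative (\<lambda>y. G y v w) (at x) u
     + frechet_derivative (\<lambda>y. G y u w) (at x) v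
     - frechet_derivative (\<lambda>y. G y u v) (at x) w)"

text \<open>The sign convention is \<open>R(u,v)w = \<nabla>\<^sub>u\<nabla>\<^sub>v w - \<nabla>\<^sub>v\<nabla>\<^sub>u w\<close> for constant fields.\<close>

definition riemann_curv ::
    "('e::euclidean_space \<Rightarrow> 'e \<Rightarrow> 'e \<Rightarrow> real) \<Rightarrow> 'e \<Rightarrow> 'e \<Rightarrow> 'e \<Rightarrow> 'e \<Rightarrow> 'e" where
  "riemann_curv G x u v w =
       frechet_derivative (\<lambda>y. christoffel G y v w) (at x) u
     - frechet_derivative (\<lambda>y. christoffel G y u w) (at x) v
     + christoffel G x u (christoffel G x v w)
     - christoffel G x v (christoffel G x u w)"

text \<open>The Ricci tensor is the trace of \<open>u \<mapsto> R(u,v)w\<close>; it is positive on round spheres.\<close>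

definition ricci_curv :: "('e::euclidean_space \<Rightarrow> 'e \<Rightarrow> 'e \<Rightarrow> real) \<Rightarrow> 'e \<Rightarrow> 'e \<Rightarrow> 'e \<Rightarrow> real" where
  "ricci_curv G x v w = (\<Sum>b\<in>Basis. riemann_curv G x b v w \<bullet> b)"

definition einstein_metric ::
    "('a, 'e::euclidean_space) chart set \<Rightarrow> 'a tensor2 \<Rightarrow> real \<Rightarrow> bool" where
  "einstein_metric A g lam \<longleftrightarrow>
     (\<forall>c\<in>A. \<forall>x\<in>chart_range c. \<forall>v w. ricci_curv (coord_expr g c) x v w = lam * coord_expr g c x v w)"

definition ricci_flat :: "('a, 'e::euclidean_space) chart set \<Rightarrow> 'a tensor2 \<Rightarrow> bool" where
  "ricci_flat A g \<longleftrightarrow> (\<forall>c\<in>A. \<forall>x\<in>chart_range c. \<forall>v w. ricci_curv (coord_expr g c) x v w = 0)"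


section \<open>Warped products\<close>

definition prod_chart :: "('a, 'e) chart \<Rightarrow> ('b, 'f) chart \<Rightarrow> ('a \<times> 'b, 'e \<times> 'f) chart" where
  "prod_chart c d = (chart_dom c \<times> chart_dom d, map_prod (chart_map c) (chart_map d))"

definition prod_atlas ::
    "('a, 'e) chart set \<Rightarrow> ('b, 'f) chart set \<Rightarrow> ('a \<times> 'b, 'e \<times> 'f) chart set" where
  "prod_atlas A B = {prod_chart c d | c d. c \<in> A \<and> d \<in> B}"

text \<open>The metric \<open>g + f\<^sup>2 h\<close>, with \<open>g\<close>, \<open>f\<close> and \<open>h\<close> pulled back along the two projections.\<close>

definition warped_metric ::
    "'a tensor2 \<Rightarrow> ('a \<Rightarrow> real) \<Rightarrow> 'b tensor2 \<Rightarrow> ('a \<times> 'b) tensor2" where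
  "warped_metric g f h z u v =
       g (fst z) (pushforward fst u) (pushforward fst v)
     + (f (fst z))\<^sup>2 * h (snd z) (pushforward snd u) (pushforward snd v)"

end

theory Submission
  imports Defs
begin

text \<open>The warped Einstein equation on the fibre directions reads
  \<open>Ric\<^sub>N - (f \<Delta>f + (m - 1) |\<nabla>f|\<^sup>2) h = lam f\<^sup>2 h\<close>. For a Ricci-flat fibre this is an equation for
  \<open>f\<close> alone, and at a critical point of \<open>f\<close> it becomes \<open>\<Delta>f = - lam f\<close>. On a compact base \<open>f\<close>
  has a maximum, where \<open>\<Delta>f \<le> 0\<close> gives \<open>lam \<ge> 0\<close>, and a minimum, where \<open>\<Delta>f \<ge> 0\<close> gives
  \<open>lam \<le> 0\<close>. So the Einstein constant must vanish, whatever the positive function \<open>f\<close>; this contradicts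
  \<open>lam \<noteq> 0\<close>, and the conclusion about \<open>f\<close> follows from the contradiction.

  Only the vertical Ricci curvature over a critical point enters, which shortens the curvature
  computation: with \<open>\<phi> = f\<^sup>2\<close>, all terms that are quadratic in \<open>D\<phi>\<close> or that involve the Levi-Civita
  connection of the base disappear. The lemma \<open>ricci_curv_vertical_critical\<close> carries this out in
  product coordinates and expresses what is left by the trace of \<open>D(grad \<phi>)\<close>, which is the Laplacian of
  \<open>\<phi>\<close> at the critical point. The sign of that trace comes from \<open>trace_nonpos\<close> and
  \<open>frechet_second_derivative_local_max\<close>.

  Gradients and Christoffel symbols are defined implicitly, as the vectors that represent a
  linear form with respect to the metric. Their differentiability is \<open>differentiable_represents\<close>.
  The lemma \<open>coord_expr_warped_metric\<close> passes from the metric on the manifold to its coordinate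
  expression, which has the expected block form.\<close>

section \<open>Derivatives of maps between open sets\<close>

lemma differentiable_cong_open:
  assumes "open S" "x \<in> S" "\<And>y. y \<in> S \<Longrightarrow> f y = g y"
  shows "f differentiable (at x) \<longleftrightarrow> g differentiable (at x)"
  using assms unfolding differentiable_def
  by (metis has_derivative_transform_within_open)

lemma frechet_derivative_cong_open:
  assumes "open S" "x \<in> S" "\<And>y. y \<in> S \<Longrightarrow> f y = g y"
  shows "frechet_derivative f (at x) = frechet_derivative g (at x)"
proof -
  have "(f has_derivative D) (at x) \<longleftrightarrow> (g has_derivative D) (at x)" for D
    using assms by (metis has_derivative_transform_within_open)
  then show ?thesis by (simp add: frechet_derivative_def)
qed

lemma frechet_derivative_eqI:
  "(f has_derivative D) (at x) \<Longrightarrow> frechet_derivative f (at x) = D"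
  by (rule frechet_derivative_at[symmetric])

lemma has_derivative_frechet:
  "f differentiable (at x) \<Longrightarrow> (f has_derivative frechet_derivative f (at x)) (at x)"
  by (simp add: frechet_derivative_works)

lemma Ck_on_cong:
  assumes "open S" "\<And>y. y \<in> S \<Longrightarrow> f y = g y"
  shows "Ck_on k S f \<longleftrightarrow> Ck_on k S g"
  using assms(2)
proof (induction k arbitrary: f g)
  case 0
  then show ?case by (simp cong: continuous_on_cong)
next
  case (Suc k)
  have "Ck_on k S (\<lambda>x. frechet_derivative f (at x) v) \<longleftrightarrow> Ck_on k S (\<lambda>x. frechet_derivative g (at x) v)"
    for v
    by (rule Suc.IH) (metis Suc.prems frechet_derivative_cong_open assms(1))
  moreover have "(\<forall>x\<in>S. f differentiable at x) \<longleftrightarrow> (\<forall>x\<in>S. g differentiable at x)"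
    using differentiable_cong_open[OF assms(1)] Suc.prems by blast
  ultimately show ?case by simp
qed

lemma Ck_on_subset:
  "Ck_on k S f \<Longrightarrow> T \<subseteq> S \<Longrightarrow> Ck_on k T f"
  by (induction k arbitrary: f) (auto intro: continuous_on_subset)

text \<open>Along an affine map the derivative of a composition is again a composition with the same
  affine map, so the induction on the order of differentiability needs no product rule.\<close>

lemma Ck_on_compose_affine:
  fixes L :: "'e::euclidean_space \<Rightarrow> 'f::euclidean_space"
  assumes "open W" "linear L" "Ck_on k W f"
  shows "Ck_on k ((\<lambda>x. L x + c) -` W) (\<lambda>x. f (L x + c))"
  using assms(3)
proof (induction k arbitrary: f)
  case 0
  have "continuous_on UNIV (\<lambda>x. L x + c)"
    using assms(2) by (intro continuous_intros linear_continuous_on) (simp add: linear_linear)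
  then show ?case
    using 0 by (auto intro!: continuous_on_compose2[of W f] elim: continuous_on_subset)
next
  case (Suc k)
  have a: "((\<lambda>x. L x + c) has_derivative L) (at x)" for x
    using assms(2) by (auto intro!: derivative_eq_intros simp: linear_linear linear_imp_has_derivative)
  have D: "((\<lambda>x. f (L x + c)) has_derivative (\<lambda>v. frechet_derivative f (at (L x + c)) (L v))) (at x)"
    if "L x + c \<in> W" for x
    using has_derivative_compose[OF a, of f _ x] has_derivative_frechet Suc.prems that
    by (metis Ck_on.simps(2))
  have "Ck_on k ((\<lambda>x. L x + c) -` W) (\<lambda>x. frechet_derivative (\<lambda>x. f (L x + c)) (at x) v)" for v
  proof (subst Ck_on_cong)
    have "continuous_on UNIV (\<lambda>x. L x + c)"
      using assms(2) by (intro continuous_intros linear_continuous_on) (simp add: linear_linear)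
    then show "open ((\<lambda>x. L x + c) -` W)"
      using assms(1) by (simp add: continuous_on_open_vimage open_vimage)
    show "frechet_derivative (\<lambda>x. f (L x + c)) (at y) v = frechet_derivative f (at (L y + c)) (L v)"
      if "y \<in> (\<lambda>x. L x + c) -` W" for y
      using D[of y] that by (simp add: frechet_derivative_eqI)
    show "Ck_on k ((\<lambda>x. L x + c) -` W) (\<lambda>y. frechet_derivative f (at (L y + c)) (L v))"
      using Suc.IH[of "\<lambda>x. frechet_derivative f (at x) (L v)"] Suc.prems by simp
  qed
  then show ?case
    using D by (auto simp: differentiable_def)
qed

section \<open>Nondegenerate bilinear forms\<close>

definition nondegenerate :: "('e::euclidean_space \<Rightarrow> 'e \<Rightarrow> real) \<Rightarrow> bool" where
  "nondegenerate B \<longleftrightarrow> (\<forall>v. (\<forall>w. B v w = 0) \<longrightarrow> v = 0)"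

lemma bilinear_linear_right: "bilinear B \<Longrightarrow> linear (B v)"
  and bilinear_linear_left: "bilinear B \<Longrightarrow> linear (\<lambda>v. B v w)"
  by (auto simp: bilinear_def)

lemma bilinear_expand_left:
  fixes B :: "'e::euclidean_space \<Rightarrow> 'e \<Rightarrow> real"
  assumes "bilinear B"
  shows "B z w = (\<Sum>a\<in>Basis. (z \<bullet> a) * B a w)"
proof -
  have "B z w = B (\<Sum>a\<in>Basis. (z \<bullet> a) *\<^sub>R a) w"
    by (simp add: euclidean_representation)
  also have "\<dots> = (\<Sum>a\<in>Basis. B ((z \<bullet> a) *\<^sub>R a) w)"
    by (rule linear_sum[OF bilinear_linear_left[OF assms]])
  finally show ?thesis
    by (simp add: bilinear_lmul[OF assms])
qed

text \<open>The form viewed as an endomorphism, by means of the Euclidean inner product.\<close>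

definition form_endo :: "('e::euclidean_space \<Rightarrow> 'e \<Rightarrow> real) \<Rightarrow> 'e \<Rightarrow> 'e" where
  "form_endo B v = (\<Sum>b\<in>Basis. B v b *\<^sub>R b)"

lemma linear_form_endo: "bilinear B \<Longrightarrow> linear (form_endo B)"
  by (rule linearI) (simp_all add: form_endo_def bilinear_ladd bilinear_lmul algebra_simps
      sum.distrib scaleR_sum_right)

lemma inj_form_endo:
  assumes "bilinear B" "nondegenerate B"
  shows "inj (form_endo B)"
proof -
  have "v = 0" if "form_endo B v = 0" for v
  proof -
    have "B v b = 0" if "b \<in> Basis" for b
      using arg_cong[OF \<open>form_endo B v = 0\<close>, of "\<lambda>z. z \<bullet> b"] that
      by (simp add: form_endo_def inner_sum_left inner_Basis if_distrib sum.delta cong: if_cong)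
    then have "B v = (\<lambda>w. 0)"
      using bilinear_linear_right[OF assms(1)] by (intro linear_eq_stdbasis) (auto simp: module_hom_zero)
    then show ?thesis
      using assms(2) by (simp add: nondegenerate_def)
  qed
  then show ?thesis
    using linear_injective_0[OF linear_form_endo[OF assms(1)]] by blast
qed

lemma nondegenerate_unique:
  assumes "bilinear B" "nondegenerate B" "\<And>w. B z w = B z' w"
  shows "z = z'"
proof -
  have "\<forall>w. B (z - z') w = 0"
    using assms(3) by (simp add: bilinear_lsub[OF assms(1)])
  then show ?thesis
    using assms(2) unfolding nondegenerate_def by fastforce
qed

lemma nondegenerate_represents:
  assumes "bilinear B" "nondegenerate B" "linear r"
  obtains z where "\<And>w. B z w = r w"
proof -
  have "surj (form_endo B)"
    using linear_form_endo[OF assms(1)] inj_form_endo[OF assms(1,2)] linear_injective_imp_surjective by auto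
  then obtain z where z: "form_endo B z = (\<Sum>b\<in>Basis. r b *\<^sub>R b)"
    by (metis surjD)
  have "B z b = r b" if "b \<in> Basis" for b
    using arg_cong[OF z, of "\<lambda>z. z \<bullet> b"] that
    by (simp add: form_endo_def inner_sum_left inner_Basis if_distrib sum.delta cong: if_cong)
  then have "B z = r"
    using bilinear_linear_right[OF assms(1)] assms(3) by (intro linear_eq_stdbasis) auto
  then show ?thesis
    by (intro that[of z]) simp
qed

text \<open>Gram-Schmidt, as an induction on the dimension: split off a unit vector \<open>e\<close> and continue in its
  \<open>B\<close>-orthogonal complement. The result is phrased as the Fourier expansion in an orthonormal basis
  because that is the form in which traces are computed.\<close>

lemma orthonormal_expansion_subspace:
  fixes S :: "'e::euclidean_space set"
  assumes "bilinear B" "\<And>v w. B v w = B w v" "\<And>v. v \<noteq> 0 \<Longrightarrow> 0 < B v v" "subspace S"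
  shows "\<exists>E. finite E \<and> E \<subseteq> S \<and> (\<forall>x\<in>S. x = (\<Sum>e\<in>E. B x e *\<^sub>R e))"
  using assms(4)
proof (induction "dim S" arbitrary: S rule: less_induct)
  case less
  show ?case
  proof (cases "S \<subseteq> {0}")
    case True
    then show ?thesis
      by (intro exI[of _ "{}"]) auto
  next
    case False
    then obtain u where u: "u \<in> S" "u \<noteq> 0" by auto
    define e where "e = (1 / sqrt (B u u)) *\<^sub>R u"
    have e: "e \<in> S" "B e e = 1"
      using u less.prems assms(3)[of u]
      by (auto simp: e_def subspace_scale bilinear_lmul[OF assms(1)] bilinear_rmul[OF assms(1)]
          power2_eq_square[symmetric] power_divide real_div_sqrt)
    define S' where "S' = {x \<in> S. B x e = 0}"
    have sub: "subspace S'"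
      using less.prems unfolding S'_def subspace_def
      by (auto simp: bilinear_ladd[OF assms(1)] bilinear_lmul[OF assms(1)] bilinear_lzero[OF assms(1)])
    have "S' \<subset> S"
      using e unfolding S'_def by force
    then have "dim S' < dim S"
      using sub less.prems by (metis dim_psubset span_eq_iff)
    then obtain E where E: "finite E" "E \<subseteq> S'" "\<And>x. x \<in> S' \<Longrightarrow> x = (\<Sum>e\<in>E. B x e *\<^sub>R e)"
      using less.hyps[OF _ sub] by blast
    have "e \<notin> E"
      using E(2) e(2) by (auto simp: S'_def)
    have "x = (\<Sum>e\<in>insert e E. B x e *\<^sub>R e)" if "x \<in> S" for x
    proof -
      let ?y = "x - B x e *\<^sub>R e"
      have "?y \<in> S'"
        using that e less.prems
        by (auto simp: S'_def subspace_diff subspace_scale bilinear_lsub[OF assms(1)] bilinear_lmul[OF assms(1)])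
      then have "?y = (\<Sum>e'\<in>E. B ?y e' *\<^sub>R e')"
        by (rule E(3))
      also have "\<dots> = (\<Sum>e'\<in>E. B x e' *\<^sub>R e')"
      proof (rule sum.cong)
        fix e' assume "e' \<in> E"
        then have "B e e' = 0"
          using E(2) assms(2)[of e e'] by (auto simp: S'_def)
        then show "B ?y e' *\<^sub>R e' = B x e' *\<^sub>R e'"
          by (simp add: bilinear_lsub[OF assms(1)] bilinear_lmul[OF assms(1)])
      qed simp
      finally show ?thesis
        using E(1) \<open>e \<notin> E\<close> by (simp add: algebra_simps)
    qed
    then show ?thesis
      using E e by (intro exI[of _ "insert e E"]) (auto simp: S'_def)
  qed
qed

text \<open>Expanding the Euclidean basis vectors in a \<open>B\<close>-orthonormal basis \<open>E\<close> turns the Euclidean trace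
  of \<open>L\<close> into the sum of the numbers \<open>B (L e) e\<close> for \<open>e\<close> in \<open>E\<close>.\<close>

lemma trace_nonpos:
  fixes B :: "'e::euclidean_space \<Rightarrow> 'e \<Rightarrow> real"
  assumes "bilinear B" "\<And>v w. B v w = B w v" "\<And>v. v \<noteq> 0 \<Longrightarrow> 0 < B v v"
    and "linear L" "\<And>v. B (L v) v \<le> 0"
  shows "(\<Sum>b\<in>Basis. L b \<bullet> b) \<le> 0"
proof -
  obtain E where E: "finite E" "\<And>x. x = (\<Sum>e\<in>E. B x e *\<^sub>R e)"
    using orthonormal_expansion_subspace[OF assms(1-3), of UNIV] by auto
  have L: "L x = (\<Sum>e\<in>E. B x e *\<^sub>R L e)" for x
    using arg_cong[OF E(2)[of x], of L] by (simp only: linear_sum[OF assms(4)] linear_scale[OF assms(4)])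
  have "L b \<bullet> b = (\<Sum>e\<in>E. B b e * (L e \<bullet> b))" for b
    using arg_cong[OF L[of b], of "\<lambda>x. x \<bullet> b"] by (simp only: inner_sum_left inner_scaleR_left)
  then have "(\<Sum>b\<in>Basis. L b \<bullet> b) = (\<Sum>b\<in>Basis. \<Sum>e\<in>E. B b e * (L e \<bullet> b))"
    by (simp only:)
  also have "\<dots> = (\<Sum>e\<in>E. \<Sum>b\<in>Basis. B b e * (L e \<bullet> b))"
    by (rule sum.swap)
  also have "\<dots> = (\<Sum>e\<in>E. B (L e) e)"
  proof (rule sum.cong)
    fix e assume "e \<in> E"
    have "B (L e) e = B (\<Sum>b\<in>Basis. (L e \<bullet> b) *\<^sub>R b) e"
      by (simp add: euclidean_representation)
    also have "\<dots> = (\<Sum>b\<in>Basis. B ((L e \<bullet> b) *\<^sub>R b) e)"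
      by (rule linear_sum[OF bilinear_linear_left[OF assms(1)]])
    finally show "(\<Sum>b\<in>Basis. B b e * (L e \<bullet> b)) = B (L e) e"
      by (simp add: bilinear_lmul[OF assms(1)] mult.commute)
  qed simp
  finally show ?thesis
    using assms(5) by (simp add: sum_nonpos)
qed

section \<open>Differentiability of representing vectors\<close>

text \<open>In the difference quotient of the product the change of \<open>\<zeta>\<close> is multiplied by the bounded quotient
  of \<open>a\<close>, so continuity of \<open>\<zeta>\<close> replaces its differentiability.\<close>

lemma has_derivative_mult_vanishing:
  fixes a \<zeta> :: "'e::real_normed_vector \<Rightarrow> real"
  assumes a: "(a has_derivative a') (at x)" "a x = 0" and \<zeta>: "isCont \<zeta> x"
  shows "((\<lambda>y. a y * \<zeta> y) has_derivative (\<lambda>v. a' v * \<zeta> x)) (at x)"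
proof -
  have bl: "bounded_linear a'"
    using a(1) by (rule has_derivative_bounded_linear)
  have lim: "((\<lambda>y. (a y - a x - a' (y - x)) /\<^sub>R norm (y - x)) \<longlongrightarrow> 0) (at x)"
    using a(1) by (simp add: has_derivative_at_within)
  obtain K where K: "\<And>v. norm (a' v) \<le> norm v * K"
    using bounded_linear.bounded[OF bl] by auto
  have bd: "\<forall>\<^sub>F y in at x. norm (a' (y - x) / norm (y - x)) \<le> K"
    using K by (auto simp: eventually_at_filter field_simps)
  have "((\<lambda>y. \<zeta> y - \<zeta> x) \<longlongrightarrow> 0) (at x)"
    using \<zeta> by (simp add: isCont_def LIM_zero)
  then have "((\<lambda>y. (a' (y - x) / norm (y - x)) * (\<zeta> y - \<zeta> x)) \<longlongrightarrow> 0) (at x)"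
    using bd by (intro lim_null_mult_left_bounded)
  moreover have "((\<lambda>y. ((a y - a x - a' (y - x)) /\<^sub>R norm (y - x)) * \<zeta> y) \<longlongrightarrow> 0 * \<zeta> x) (at x)"
    using lim \<zeta> by (intro tendsto_mult) (auto simp: isCont_def)
  ultimately have "((\<lambda>y. ((a y - a x - a' (y - x)) /\<^sub>R norm (y - x)) * \<zeta> y
      + (a' (y - x) / norm (y - x)) * (\<zeta> y - \<zeta> x)) \<longlongrightarrow> 0) (at x)"
    by (auto intro: tendsto_add[where a=0 and b=0, simplified])
  moreover have "((a y - a x - a' (y - x)) /\<^sub>R norm (y - x)) * \<zeta> y
      + (a' (y - x) / norm (y - x)) * (\<zeta> y - \<zeta> x)
    = (a y * \<zeta> y - a x * \<zeta> x - a' (y - x) * \<zeta> x) /\<^sub>R norm (y - x)" for y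
    using a(2) by (simp add: divide_inverse algebra_simps)
  ultimately show ?thesis
    using bl by (simp add: has_derivative_at_within bounded_linear_mult_const)
qed

text \<open>As \<open>E\<close> tends to \<open>0\<close>, half of the left-hand side absorbs the part of \<open>E x * norm (z x)\<close> that
  comes from \<open>z x - z x0\<close>; no bound on \<open>z\<close> has to be known beforehand.\<close>

lemma isCont_fixed_point_estimate:
  fixes z :: "'e::euclidean_space \<Rightarrow> 'f::real_normed_vector"
  assumes E: "(E \<longlongrightarrow> 0) (at x0)" and D: "(D \<longlongrightarrow> (0::real)) (at x0)"
    and le: "\<forall>\<^sub>F x in at x0. norm (z x - z x0) \<le> E x * norm (z x) + D x"
  shows "isCont z x0"
proof -
  have "\<forall>\<^sub>F x in at x0. E x < 1/2"
    using E by (rule order_tendstoD) simp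
  moreover have "\<forall>\<^sub>F x in at x0. norm (E x) < 1/2"
    using tendsto_norm_zero[OF E] by (rule order_tendstoD) simp
  ultimately have "\<forall>\<^sub>F x in at x0. norm (z x - z x0) \<le> 2 * (\<bar>E x\<bar> * norm (z x0) + D x)"
    using le
  proof eventually_elim
    case (elim x)
    have "norm (z x) \<le> norm (z x - z x0) + norm (z x0)"
      by (metis add.commute diff_add_cancel norm_triangle_ineq)
    then have "\<bar>E x\<bar> * norm (z x) \<le> \<bar>E x\<bar> * norm (z x - z x0) + \<bar>E x\<bar> * norm (z x0)"
      by (metis abs_ge_zero distrib_left mult_left_mono)
    moreover have "\<bar>E x\<bar> * norm (z x - z x0) \<le> 1/2 * norm (z x - z x0)"
      using elim by (intro mult_right_mono) auto
    moreover have "E x * norm (z x) \<le> \<bar>E x\<bar> * norm (z x)"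
      by (intro mult_right_mono) auto
    ultimately show ?case
      using elim(3) unfolding distrib_left by linarith
  qed
  moreover have "((\<lambda>x. 2 * (\<bar>E x\<bar> * norm (z x0) + D x)) \<longlongrightarrow> 0) (at x0)"
    using tendsto_mult_left[OF tendsto_add[OF tendsto_mult_right[OF tendsto_rabs[OF E], of "norm (z x0)"] D], of 2]
    by (simp only: abs_zero mult_zero_left mult_zero_right add_0_left)
  ultimately have "((\<lambda>x. z x - z x0) \<longlongrightarrow> 0) (at x0)"
    by (rule Lim_null_comparison)
  then show ?thesis
    by (simp add: isCont_def LIM_zero_cancel)
qed

text \<open>Freezing the coefficients at \<open>x0\<close> and inverting there turns the equation \<open>B x (z x) = r x\<close> into
  a fixed-point equation \<open>z = T (q + R)\<close>, in which \<open>q\<close> is linear in \<open>z\<close> with coefficients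
  \<open>\<delta> = B x0 - B x\<close> that vanish at \<open>x0\<close>. This gives first the continuity of \<open>z\<close> at \<open>x0\<close>, and then, since
  a vanishing differentiable factor times a continuous one is differentiable, its differentiability.\<close>

lemma differentiable_represents:
  fixes B :: "'x::euclidean_space \<Rightarrow> 'e::euclidean_space \<Rightarrow> 'e \<Rightarrow> real"
  assumes S: "open S" "x0 \<in> S"
    and bil: "\<And>x. x \<in> S \<Longrightarrow> bilinear (B x)" and nd: "nondegenerate (B x0)"
    and B: "\<And>v w. (\<lambda>x. B x v w) differentiable (at x0)"
    and r: "\<And>w. (\<lambda>x. r x w) differentiable (at x0)"
    and z: "\<And>x w. x \<in> S \<Longrightarrow> B x (z x) w = r x w"
  shows "z differentiable (at x0)"
proof -
  have lin: "linear (form_endo (B x0))"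
    using S bil by (simp add: linear_form_endo)
  obtain T where T: "linear T" "\<And>v. T (form_endo (B x0) v) = v"
    using linear_injective_left_inverse[OF lin inj_form_endo] S bil nd
    by (metis comp_apply id_apply)
  define \<delta> where "\<delta> a b x = B x0 a b - B x a b" for a b x
  define R where "R x = (\<Sum>b\<in>Basis. r x b *\<^sub>R b)" for x
  \<comment> \<open>This is \<open>form_endo (B x0) - form_endo (B x)\<close>, applied to \<open>z x\<close>.\<close>
  define q where "q x = (\<Sum>b\<in>Basis. (\<Sum>a\<in>Basis. \<delta> a b x * (z x \<bullet> a)) *\<^sub>R b)" for x
  have fixpt: "z x = T (q x + R x)" if "x \<in> S" for x
  proof -
    have "form_endo (B x0) (z x) = q x + R x"
      unfolding form_endo_def q_def R_def sum.distrib[symmetric] scaleR_add_left[symmetric]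
    proof (rule sum.cong)
      fix b :: 'e assume "b \<in> Basis"
      have "B x0 (z x) b = (\<Sum>a\<in>Basis. \<delta> a b x * (z x \<bullet> a)) + B x (z x) b"
        unfolding bilinear_expand_left[OF bil[OF S(2)], of "z x" b]
          bilinear_expand_left[OF bil[OF that], of "z x" b]
        by (simp add: \<delta>_def sum.distrib[symmetric] algebra_simps)
      then show "B x0 (z x) b *\<^sub>R b = ((\<Sum>a\<in>Basis. \<delta> a b x * (z x \<bullet> a)) + r x b) *\<^sub>R b"
        using z[OF that] by simp
    qed simp
    then show ?thesis
      using T(2) by metis
  qed
  have \<delta>: "\<delta> a b differentiable (at x0)" "\<delta> a b x0 = 0" for a b
    using B by (auto simp: \<delta>_def[abs_def])
  have R: "R differentiable (at x0)"
    using r unfolding R_def[abs_def] by (intro derivative_intros) auto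
  obtain K where K: "K > 0" "\<And>v. norm (T v) \<le> K * norm v"
    using linear_bounded_pos[OF T(1)] by blast
  have "isCont z x0"
  proof (rule isCont_fixed_point_estimate)
    define E where "E x = K * (\<Sum>b\<in>Basis. \<Sum>a\<in>Basis. \<bar>\<delta> a b x\<bar>)" for x
    define D where "D x = K * norm (R x - R x0)" for x
    have "((\<lambda>x. \<delta> a b x) \<longlongrightarrow> 0) (at x0)" for a b
      using differentiable_imp_continuous_within[OF \<delta>(1)[of a b]] \<delta>(2)[of a b]
      by (simp add: continuous_within)
    then have "(E \<longlongrightarrow> K * (\<Sum>b\<in>(Basis::'e set). \<Sum>a\<in>(Basis::'e set). \<bar>0\<bar>)) (at x0)"
      unfolding E_def[abs_def] by (intro tendsto_intros)
    then show "(E \<longlongrightarrow> 0) (at x0)"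
      by simp
    have "(R \<longlongrightarrow> R x0) (at x0)"
      using differentiable_imp_continuous_within[OF R] by (simp add: continuous_within)
    then have "(D \<longlongrightarrow> K * norm (R x0 - R x0)) (at x0)"
      unfolding D_def[abs_def] by (intro tendsto_intros)
    then show "(D \<longlongrightarrow> 0) (at x0)"
      by simp
    have "norm (z x - z x0) \<le> E x * norm (z x) + D x" if "x \<in> S" for x
    proof -
      have "q x0 = 0"
        by (simp add: q_def \<delta>(2))
      then have "z x - z x0 = T (q x + (R x - R x0))"
        using fixpt[OF that] fixpt[OF S(2)] by (simp add: linear_diff[OF T(1), symmetric] algebra_simps)
      then have "norm (z x - z x0) \<le> K * norm (q x + (R x - R x0))"
        using K(2) by simp
      also have "\<dots> \<le> K * (norm (q x) + norm (R x - R x0))"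
        using K(1) by (intro mult_left_mono norm_triangle_ineq) auto
      also have "norm (q x) \<le> (\<Sum>b\<in>Basis. \<Sum>a\<in>Basis. \<bar>\<delta> a b x\<bar>) * norm (z x)"
        unfolding q_def sum_distrib_right
      proof (rule sum_norm_le)
        fix b :: 'e assume b: "b \<in> Basis"
        have "\<bar>\<Sum>a\<in>Basis. \<delta> a b x * (z x \<bullet> a)\<bar> \<le> (\<Sum>a\<in>Basis. \<bar>\<delta> a b x * (z x \<bullet> a)\<bar>)"
          by (rule sum_abs)
        also have "\<dots> \<le> (\<Sum>a\<in>Basis. \<bar>\<delta> a b x\<bar> * norm (z x))"
          by (intro sum_mono) (auto simp: abs_mult Basis_le_norm intro: mult_left_mono)
        finally show "norm ((\<Sum>a\<in>Basis. \<delta> a b x * (z x \<bullet> a)) *\<^sub>R b) \<le> (\<Sum>a\<in>Basis. \<bar>\<delta> a b x\<bar> * norm (z x))"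
          using b by simp
      qed
      finally show ?thesis
        using K(1) by (simp add: E_def D_def algebra_simps)
    qed
    then show "\<forall>\<^sub>F x in at x0. norm (z x - z x0) \<le> E x * norm (z x) + D x"
      using S by (auto simp: eventually_at_topological)
  qed
  then have "(\<lambda>x. \<delta> a b x * (z x \<bullet> a)) differentiable (at x0)" for a b
    using has_derivative_mult_vanishing[OF has_derivative_frechet[OF \<delta>(1)] \<delta>(2), of "\<lambda>x. z x \<bullet> a"]
    by (intro differentiableI) (auto intro!: continuous_intros)
  then have "q differentiable (at x0)"
    unfolding q_def[abs_def] by (intro derivative_intros) auto
  then have "(\<lambda>x. T (q x + R x)) differentiable (at x0)"
    using differentiable_add[OF _ R]
      bounded_linear.has_derivative[OF linear_conv_bounded_linear[THEN iffD1, OF T(1)]]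
    unfolding differentiable_def by blast
  then show ?thesis
    using differentiable_cong_open[OF S fixpt] by simp
qed

section \<open>The second derivative at a maximum\<close>

text \<open>Were the second derivative in direction \<open>e\<close> positive, the first one would be positive
  shortly after \<open>x0\<close> on the line in direction \<open>e\<close>, and \<open>\<phi>\<close> would increase along it.\<close>

lemma frechet_second_derivative_local_max:
  fixes \<phi> :: "'e::euclidean_space \<Rightarrow> real"
  assumes S: "open S" "x0 \<in> S" and diff: "\<And>x. x \<in> S \<Longrightarrow> \<phi> differentiable (at x)"
    and diff2: "(\<lambda>x. frechet_derivative \<phi> (at x) e) differentiable (at x0)"
    and max: "\<And>x. x \<in> S \<Longrightarrow> \<phi> x \<le> \<phi> x0"
  shows "frechet_derivative \<phi> (at x0) = (\<lambda>v. 0)"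
    and "frechet_derivative (\<lambda>x. frechet_derivative \<phi> (at x) e) (at x0) e \<le> 0"
proof -
  show crit: "frechet_derivative \<phi> (at x0) = (\<lambda>v. 0)"
    using has_derivative_local_max[OF has_derivative_frechet[OF diff[OF S(2)]]] max S
    by (auto simp: eventually_at_topological)
  show "frechet_derivative (\<lambda>x. frechet_derivative \<phi> (at x) e) (at x0) e \<le> 0"
  proof (rule ccontr)
    assume "\<not> ?thesis"
    then have pos: "frechet_derivative (\<lambda>x. frechet_derivative \<phi> (at x) e) (at x0) e > 0" (is "?c > 0")
      by simp
    have line: "((\<lambda>t. x0 + t *\<^sub>R e) has_derivative (\<lambda>s. s *\<^sub>R e)) (at t)" for t
      by (auto intro!: derivative_eq_intros)
    have D: "((\<lambda>t. \<phi> (x0 + t *\<^sub>R e)) has_real_derivative frechet_derivative \<phi> (at (x0 + t *\<^sub>R e)) e) (at t)"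
      if "x0 + t *\<^sub>R e \<in> S" for t
      using has_derivative_compose[OF line has_derivative_frechet[OF diff[OF that]]]
        linear_frechet_derivative[OF diff[OF that]]
      by (simp add: has_field_derivative_def linear_scale mult.commute[of _ "frechet_derivative _ _ _"])
    have "((\<lambda>t. frechet_derivative \<phi> (at (x0 + t *\<^sub>R e)) e) has_real_derivative ?c) (at 0)"
      using has_derivative_compose[OF line[of 0], of "\<lambda>x. frechet_derivative \<phi> (at x) e",
          unfolded scale_zero_left add_0_right, OF has_derivative_frechet[OF diff2]]
        linear_frechet_derivative[OF diff2]
      by (simp add: has_field_derivative_def linear_scale mult.commute[of _ ?c])
    from DERIV_pos_inc_right[OF this pos] obtain d where d: "d > 0"
      "\<And>h. h > 0 \<Longrightarrow> h < d \<Longrightarrow> 0 < frechet_derivative \<phi> (at (x0 + h *\<^sub>R e)) e"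
      using crit by auto
    have "((\<lambda>t. x0 + t *\<^sub>R e) \<longlongrightarrow> x0 + 0 *\<^sub>R e) (at 0)"
      by (intro tendsto_intros)
    then have "\<forall>\<^sub>F t in at 0. x0 + t *\<^sub>R e \<in> S"
      using S by (intro topological_tendstoD[of _ x0]) auto
    then obtain d' where d': "d' > 0" "\<forall>t. t \<noteq> 0 \<and> dist t 0 < d' \<longrightarrow> x0 + t *\<^sub>R e \<in> S"
      unfolding eventually_at by auto
    have in_S: "x0 + t *\<^sub>R e \<in> S" if "\<bar>t\<bar> < d'" for t
      using d'(2) S(2) that by (cases "t = 0") (auto simp: dist_real_def)
    define t where "t = min d d' / 2"
    have t: "0 < t" "t < d" "t < d'"
      using d(1) d'(1) by (auto simp: t_def)
    have "\<phi> (x0 + 0 *\<^sub>R e) < \<phi> (x0 + t *\<^sub>R e)"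
    proof (rule DERIV_pos_imp_increasing_open[OF t(1)])
      show "\<exists>y. ((\<lambda>t. \<phi> (x0 + t *\<^sub>R e)) has_real_derivative y) (at s) \<and> 0 < y"
        if "0 < s" "s < t" for s
        using D[of s] in_S[of s] d(2)[of s] that t by auto
      show "continuous_on {0..t} (\<lambda>t. \<phi> (x0 + t *\<^sub>R e))"
      proof (rule DERIV_continuous_on)
        show "((\<lambda>t. \<phi> (x0 + t *\<^sub>R e)) has_real_derivative frechet_derivative \<phi> (at (x0 + s *\<^sub>R e)) e)
            (at s within {0..t})" if "s \<in> {0..t}" for s
          using D[of s] in_S[of s] that t by (auto intro: has_field_derivative_at_within)
      qed
    qed
    then show False
      using max[OF in_S[of t]] t by auto
  qed
qed

section \<open>Gradient and Christoffel symbols\<close>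

definition gradient :: "('e::euclidean_space \<Rightarrow> 'e \<Rightarrow> 'e \<Rightarrow> real) \<Rightarrow> ('e \<Rightarrow> real) \<Rightarrow> 'e \<Rightarrow> 'e" where
  "gradient G \<phi> x = (THE z. \<forall>w. G x z w = frechet_derivative \<phi> (at x) w)"

lemma gradient_eqI:
  assumes "bilinear (G x)" "nondegenerate (G x)" "\<And>w. G x z w = frechet_derivative \<phi> (at x) w"
  shows "gradient G \<phi> x = z"
  unfolding gradient_def using assms
  by (intro the_equality) (auto intro: nondegenerate_unique[of "G x"])

lemma gradient:
  assumes "bilinear (G x)" "nondegenerate (G x)" "\<phi> differentiable (at x)"
  shows "G x (gradient G \<phi> x) w = frechet_derivative \<phi> (at x) w"
proof -
  obtain z where z: "\<And>w. G x z w = frechet_derivative \<phi> (at x) w"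
    using nondegenerate_represents[OF assms(1,2) linear_frechet_derivative[OF assms(3)]] by metis
  then show ?thesis
    using gradient_eqI[of G, OF assms(1,2) z] by simp
qed

lemma christoffel_eqI:
  assumes "bilinear (G x)" "nondegenerate (G x)"
    and "\<And>w. 2 * G x z w = frechet_derivative (\<lambda>y. G y v w) (at x) u
     + frechet_derivative (\<lambda>y. G y u w) (at x) v - frechet_derivative (\<lambda>y. G y u v) (at x) w"
  shows "christoffel G x u v = z"
  unfolding christoffel_def
proof (rule the_equality)
  fix z' assume z': "\<forall>w. 2 * G x z' w = frechet_derivative (\<lambda>y. G y v w) (at x) u
     + frechet_derivative (\<lambda>y. G y u w) (at x) v - frechet_derivative (\<lambda>y. G y u v) (at x) w"
  have "G x z' w = G x z w" for w
    using spec[OF z', of w] assms(3)[of w] by linarith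
  then show "z' = z"
    by (rule nondegenerate_unique[OF assms(1,2)])
qed (use assms(3) in blast)

lemma frechet_derivative_form_zero:
  assumes "open T" "y \<in> T" "\<And>y. y \<in> T \<Longrightarrow> bilinear (H y)"
  shows "frechet_derivative (\<lambda>y. H y 0 w) (at y) u = 0"
    and "frechet_derivative (\<lambda>y. H y w 0) (at y) u = 0"
  using frechet_derivative_cong_open[OF assms(1,2), of "\<lambda>y. H y 0 w" "\<lambda>_. 0"]
    frechet_derivative_cong_open[OF assms(1,2), of "\<lambda>y. H y w 0" "\<lambda>_. 0"]
    bilinear_lzero[OF assms(3)] bilinear_rzero[OF assms(3)]
  by auto

text \<open>The Koszul expression has to be linear in its last argument to be represented by a vector; in
  two of its three terms that argument sits inside the metric.\<close>

lemma linear_frechet_derivative_form: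
  fixes H :: "'x::real_normed_vector \<Rightarrow> 'e::real_vector \<Rightarrow> 'e \<Rightarrow> real"
  assumes "open T" "y \<in> T" "\<And>y. y \<in> T \<Longrightarrow> bilinear (H y)"
    and "\<And>v w. (\<lambda>y. H y v w) differentiable (at y)"
  shows "linear (\<lambda>w. frechet_derivative (\<lambda>y. H y v w) (at y) u)"
proof (rule linearI)
  note d = has_derivative_frechet[OF assms(4)]
  show "frechet_derivative (\<lambda>y. H y v (w + w')) (at y) u =
      frechet_derivative (\<lambda>y. H y v w) (at y) u + frechet_derivative (\<lambda>y. H y v w') (at y) u" for w w'
  proof -
    have "frechet_derivative (\<lambda>y. H y v (w + w')) (at y) = frechet_derivative (\<lambda>y. H y v w + H y v w') (at y)"
      using assms by (intro frechet_derivative_cong_open[of T]) (auto simp: bilinear_radd)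
    then show ?thesis
      using frechet_derivative_eqI[OF has_derivative_add[OF d d]] by simp
  qed
  show "frechet_derivative (\<lambda>y. H y v (c *\<^sub>R w)) (at y) u = c *\<^sub>R frechet_derivative (\<lambda>y. H y v w) (at y) u" for c w
  proof -
    have "frechet_derivative (\<lambda>y. H y v (c *\<^sub>R w)) (at y) = frechet_derivative (\<lambda>y. c * H y v w) (at y)"
      using assms by (intro frechet_derivative_cong_open[of T]) (auto simp: bilinear_rmul)
    then show ?thesis
      using frechet_derivative_eqI[OF has_derivative_mult_right[OF d]] by simp
  qed
qed

lemma christoffel:
  assumes "open T" "y \<in> T" "\<And>y. y \<in> T \<Longrightarrow> bilinear (H y)" "nondegenerate (H y)"
    and "\<And>v w. (\<lambda>y. H y v w) differentiable (at y)"
  shows "2 * H y (christoffel H y u v) w = frechet_derivative (\<lambda>y. H y v w) (at y) u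
     + frechet_derivative (\<lambda>y. H y u w) (at y) v - frechet_derivative (\<lambda>y. H y u v) (at y) w"
proof -
  let ?k = "\<lambda>w. frechet_derivative (\<lambda>y. H y v w) (at y) u
     + frechet_derivative (\<lambda>y. H y u w) (at y) v - frechet_derivative (\<lambda>y. H y u v) (at y) w"
  note bil = assms(3)[OF assms(2)]
  have "linear (\<lambda>w. (1/2) *\<^sub>R ?k w)"
    by (intro linear_compose_scale_right linear_compose_sub linear_compose_add
        linear_frechet_derivative_form[OF assms(1,2,3,5)] linear_frechet_derivative assms(5))
  then obtain z where z: "\<And>w. H y z w = (1/2) *\<^sub>R ?k w"
    using nondegenerate_represents[OF bil assms(4)] by blast
  have "christoffel H y u v = z"
    using z by (intro christoffel_eqI[of H, OF bil assms(4)]) (simp add: mult.commute)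
  then show ?thesis
    using z by (simp add: mult.commute)
qed

lemma differentiable_christoffel:
  assumes "open T" "y0 \<in> T" "\<And>y. y \<in> T \<Longrightarrow> bilinear (H y)" "\<And>y. y \<in> T \<Longrightarrow> nondegenerate (H y)"
    and "\<And>y v w. y \<in> T \<Longrightarrow> (\<lambda>y. H y v w) differentiable (at y)"
    and "\<And>u v w. (\<lambda>y. frechet_derivative (\<lambda>y. H y v w) (at y) u) differentiable (at y0)"
  shows "(\<lambda>y. christoffel H y u v) differentiable (at y0)"
proof (rule differentiable_represents[OF assms(1,2)])
  show "H y (christoffel H y u v) w = (1/2) * (frechet_derivative (\<lambda>y. H y v w) (at y) u
     + frechet_derivative (\<lambda>y. H y u w) (at y) v - frechet_derivative (\<lambda>y. H y u v) (at y) w)"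
    if "y \<in> T" for y w
    using christoffel[OF assms(1) that assms(3) assms(4)[OF that] assms(5)[OF that], of u v w] by simp
  show "(\<lambda>y. (1/2) * (frechet_derivative (\<lambda>y. H y v w) (at y) u
     + frechet_derivative (\<lambda>y. H y u w) (at y) v - frechet_derivative (\<lambda>y. H y u v) (at y) w))
       differentiable (at y0)" for w
    by (intro differentiable_mult differentiable_diff differentiable_add differentiable_const assms(6))
qed (use assms in auto)

lemma differentiable_gradient:
  assumes "open S" "x0 \<in> S" "\<And>x. x \<in> S \<Longrightarrow> bilinear (G x)" "\<And>x. x \<in> S \<Longrightarrow> nondegenerate (G x)"
    and "\<And>v w. (\<lambda>x. G x v w) differentiable (at x0)"
    and "\<And>x. x \<in> S \<Longrightarrow> \<phi> differentiable (at x)"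
    and "\<And>v. (\<lambda>x. frechet_derivative \<phi> (at x) v) differentiable (at x0)"
  shows "gradient G \<phi> differentiable (at x0)"
  by (rule differentiable_represents[where B = G and r = "\<lambda>x. frechet_derivative \<phi> (at x)",
        OF assms(1,2)])
    (use assms gradient[of G] in auto)

text \<open>Differentiating \<open>G (gradient G \<phi>) w = D\<phi> w\<close> at a critical point, the terms with
  derivatives of \<open>G\<close> carry a factor \<open>gradient G \<phi> = 0\<close>.\<close>

lemma derivative_gradient_critical:
  assumes "open S" "x0 \<in> S" "\<And>x. x \<in> S \<Longrightarrow> bilinear (G x)" "\<And>x. x \<in> S \<Longrightarrow> nondegenerate (G x)"
    and "\<And>v w. (\<lambda>x. G x v w) differentiable (at x0)"
    and "\<And>x. x \<in> S \<Longrightarrow> \<phi> differentiable (at x)"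
    and "\<And>v. (\<lambda>x. frechet_derivative \<phi> (at x) v) differentiable (at x0)"
    and crit: "frechet_derivative \<phi> (at x0) = (\<lambda>v. 0)"
  shows "G x0 (frechet_derivative (gradient G \<phi>) (at x0) u) w =
    frechet_derivative (\<lambda>x. frechet_derivative \<phi> (at x) w) (at x0) u"
proof -
  let ?D = "frechet_derivative (gradient G \<phi>) (at x0)"
  note bil = assms(3)[OF assms(2)]
  have grad0: "gradient G \<phi> x0 = 0"
    by (rule gradient_eqI[of G, OF bil assms(4)[OF assms(2)]]) (simp add: crit bilinear_lzero[OF bil])
  have dgrad: "(gradient G \<phi> has_derivative ?D) (at x0)"
    by (rule has_derivative_frechet[OF differentiable_gradient[OF assms(1-7)]])
  have dG: "((\<lambda>x. G x a w) has_derivative frechet_derivative (\<lambda>x. G x a w) (at x0)) (at x0)" for a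
    by (rule has_derivative_frechet[OF assms(5)])
  have "frechet_derivative (\<lambda>x. frechet_derivative \<phi> (at x) w) (at x0) =
      frechet_derivative (\<lambda>x. \<Sum>a\<in>Basis. (gradient G \<phi> x \<bullet> a) * G x a w) (at x0)"
  proof (rule frechet_derivative_cong_open[OF assms(1,2)])
    fix x assume "x \<in> S"
    then show "frechet_derivative \<phi> (at x) w = (\<Sum>a\<in>Basis. (gradient G \<phi> x \<bullet> a) * G x a w)"
      using gradient[of G x \<phi> w] bilinear_expand_left[of "G x" "gradient G \<phi> x" w] assms(3,4,6) by metis
  qed
  also have "\<dots> = (\<lambda>u. \<Sum>a\<in>Basis. (?D u \<bullet> a) * G x0 a w)"
    by (rule frechet_derivative_eqI) (auto intro!: derivative_eq_intros dgrad dG simp: grad0)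
  finally show ?thesis
    using bilinear_expand_left[OF bil, of "?D u" w] by simp
qed

section \<open>Curvature of a warped product in coordinates\<close>

lemma sum_Basis_prod:
  "(\<Sum>p\<in>(Basis :: ('e::euclidean_space \<times> 'f::euclidean_space) set). \<psi> p) =
    (\<Sum>b\<in>Basis. \<psi> (b, 0)) + (\<Sum>b\<in>Basis. \<psi> (0, b))"
proof -
  have "(\<lambda>b. (b, 0)) ` Basis \<inter> (\<lambda>b. (0, b)) ` Basis = ({} :: ('e \<times> 'f) set)"
    by (auto simp: nonzero_Basis)
  then show ?thesis
    unfolding Basis_prod_def
    by (subst sum.union_disjoint) (auto simp: sum.reindex inj_on_def)
qed

text \<open>The product coordinates range over \<open>S \<times> T\<close>, with base metric \<open>G\<close>, fibre metric \<open>H\<close> and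
  squared warping function \<open>\<phi>\<close>. The block form of \<open>K\<close> is required on \<open>S \<times> T\<close> only, since the coordinate
  expression of a metric takes arbitrary values outside the range of the chart.\<close>

locale warped_coordinates =
  fixes S :: "'e::euclidean_space set" and T :: "'f::euclidean_space set"
    and G :: "'e \<Rightarrow> 'e \<Rightarrow> 'e \<Rightarrow> real" and H :: "'f \<Rightarrow> 'f \<Rightarrow> 'f \<Rightarrow> real"
    and \<phi> :: "'e \<Rightarrow> real" and K :: "'e \<times> 'f \<Rightarrow> 'e \<times> 'f \<Rightarrow> 'e \<times> 'f \<Rightarrow> real"
  assumes open_S: "open S" and open_T: "open T"
    and G_bil: "x \<in> S \<Longrightarrow> bilinear (G x)" and G_nd: "x \<in> S \<Longrightarrow> nondegenerate (G x)"
    and G_diff: "x \<in> S \<Longrightarrow> (\<lambda>x. G x a a') differentiable (at x)"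
    and H_bil: "y \<in> T \<Longrightarrow> bilinear (H y)" and H_nd: "y \<in> T \<Longrightarrow> nondegenerate (H y)"
    and H_diff: "y \<in> T \<Longrightarrow> (\<lambda>y. H y v w) differentiable (at y)"
    and H_diff2: "y \<in> T \<Longrightarrow> (\<lambda>y. frechet_derivative (\<lambda>y. H y v w) (at y) u) differentiable (at y)"
    and \<phi>_nz: "x \<in> S \<Longrightarrow> \<phi> x \<noteq> 0"
    and \<phi>_diff: "x \<in> S \<Longrightarrow> \<phi> differentiable (at x)"
    and \<phi>_diff2: "x \<in> S \<Longrightarrow> (\<lambda>x. frechet_derivative \<phi> (at x) a) differentiable (at x)"
    and K_eq: "x \<in> S \<Longrightarrow> y \<in> T \<Longrightarrow> K (x, y) (a, v) (a', w) = G x a a' + \<phi> x * H y v w"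
begin

lemma K_bil:
  assumes "x \<in> S" "y \<in> T"
  shows "bilinear (K (x, y))"
proof -
  note G = G_bil[OF assms(1)] and H = H_bil[OF assms(2)]
  have "linear (K (x, y) p)" "linear (\<lambda>p. K (x, y) p q)" for p q
    by (cases p; cases q; rule linearI;
        clarsimp simp: K_eq[OF assms] bilinear_radd[OF G] bilinear_radd[OF H] bilinear_rmul[OF G]
          bilinear_rmul[OF H] bilinear_ladd[OF G] bilinear_ladd[OF H] bilinear_lmul[OF G]
          bilinear_lmul[OF H] algebra_simps)+
  then show ?thesis
    by (simp add: bilinear_def)
qed

lemma K_nd:
  assumes "x \<in> S" "y \<in> T"
  shows "nondegenerate (K (x, y))"
  unfolding nondegenerate_def
proof (intro allI impI)
  fix p assume "\<forall>q. K (x, y) p q = 0"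
  moreover obtain b v where p: "p = (b, v)" by (cases p)
  ultimately have *: "K (x, y) (b, v) (a, w) = 0" for a w
    by simp
  have "G x b a = 0" for a
    using *[of a 0] bilinear_rzero[OF H_bil] assms by (simp add: K_eq)
  moreover have "H y v w = 0" for w
    using *[of 0 w] bilinear_rzero[OF G_bil] assms \<phi>_nz by (simp add: K_eq)
  ultimately show "p = 0"
    using G_nd[OF assms(1)] H_nd[OF assms(2)] by (simp add: nondegenerate_def p zero_prod_def)
qed

lemma frechet_derivative_K:
  assumes "x \<in> S" "y \<in> T"
  shows "frechet_derivative (\<lambda>z. K z (a, v) (a', w)) (at (x, y)) (b, u) =
    frechet_derivative (\<lambda>x. G x a a') (at x) b + frechet_derivative \<phi> (at x) b * H y v w
      + \<phi> x * frechet_derivative (\<lambda>y. H y v w) (at y) u"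
proof -
  have fst: "(fst has_derivative fst) (at (x, y))" and snd: "(snd has_derivative snd) (at (x, y))"
    by (auto intro!: derivative_eq_intros)
  have 1: "((\<lambda>z. G (fst z) a a') has_derivative (\<lambda>p. frechet_derivative (\<lambda>x. G x a a') (at x) (fst p))) (at (x, y))"
    using has_derivative_compose[OF fst, of "\<lambda>x. G x a a'"] has_derivative_frechet[OF G_diff[OF assms(1)]] by simp
  have 2: "((\<lambda>z. \<phi> (fst z)) has_derivative (\<lambda>p. frechet_derivative \<phi> (at x) (fst p))) (at (x, y))"
    using has_derivative_compose[OF fst, of \<phi>] has_derivative_frechet[OF \<phi>_diff[OF assms(1)]] by simp
  have 3: "((\<lambda>z. H (snd z) v w) has_derivative (\<lambda>p. frechet_derivative (\<lambda>y. H y v w) (at y) (snd p))) (at (x, y))"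
    using has_derivative_compose[OF snd, of "\<lambda>y. H y v w"] has_derivative_frechet[OF H_diff[OF assms(2)]] by simp
  have "frechet_derivative (\<lambda>z. K z (a, v) (a', w)) (at (x, y)) =
      frechet_derivative (\<lambda>z. G (fst z) a a' + \<phi> (fst z) * H (snd z) v w) (at (x, y))"
    by (rule frechet_derivative_cong_open[of "S \<times> T"])
      (use assms open_S open_T K_eq in \<open>auto simp: open_Times\<close>)
  then show ?thesis
    using frechet_derivative_eqI[OF has_derivative_add[OF 1 has_derivative_mult[OF 2 3]]] by simp
qed

text \<open>Horizontal test vectors see only the derivative of the factor \<open>\<phi>\<close> in \<open>\<phi> x * H y v w\<close>, which
  gives the gradient part; vertical ones see \<open>\<phi>\<close> times the Koszul formula of the fibre.\<close>

lemma christoffel_vertical: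
  assumes "x \<in> S" "y \<in> T"
  shows "christoffel K (x, y) (0, v) (0, w) = (- (H y v w / 2) *\<^sub>R gradient G \<phi> x, christoffel H y v w)"
proof (rule christoffel_eqI[of K, OF K_bil[OF assms] K_nd[OF assms]])
  fix q :: "'e \<times> 'f"
  obtain a u where q: "q = (a, u)" by (cases q)
  note G0 = frechet_derivative_form_zero[of S x G, OF open_S assms(1) G_bil]
  have lin: "frechet_derivative f (at x) 0 = 0" if "f differentiable (at x)" for f :: "'e \<Rightarrow> real"
    using linear_0[OF linear_frechet_derivative[OF that]] .
  show "2 * K (x, y) (- (H y v w / 2) *\<^sub>R gradient G \<phi> x, christoffel H y v w) q =
      frechet_derivative (\<lambda>z. K z (0, w) q) (at (x, y)) (0, v)
      + frechet_derivative (\<lambda>z. K z (0, v) q) (at (x, y)) (0, w)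
      - frechet_derivative (\<lambda>z. K z (0, v) (0, w)) (at (x, y)) q"
    using christoffel[OF open_T assms(2) H_bil H_nd[OF assms(2)] H_diff[OF assms(2)], of v w u]
      gradient[of G, OF G_bil[OF assms(1)] G_nd[OF assms(1)] \<phi>_diff[OF assms(1)], of a]
    unfolding q frechet_derivative_K[OF assms] K_eq[OF assms]
    by (simp add: G0 lin[OF \<phi>_diff[OF assms(1)]] bilinear_lmul[OF G_bil[OF assms(1)]]
        right_diff_distrib[symmetric] distrib_left[symmetric] bilinear_lneg[OF G_bil[OF assms(1)]])
qed

lemma christoffel_mixed:
  assumes "x \<in> S" "y \<in> T"
  shows "christoffel K (x, y) (b, 0) (0, w) = (0, (frechet_derivative \<phi> (at x) b / (2 * \<phi> x)) *\<^sub>R w)"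
proof (rule christoffel_eqI[of K, OF K_bil[OF assms] K_nd[OF assms]])
  fix q :: "'e \<times> 'f"
  obtain a u where q: "q = (a, u)" by (cases q)
  note G0 = frechet_derivative_form_zero[of S x G, OF open_S assms(1) G_bil]
  note H0 = frechet_derivative_form_zero[of T y H, OF open_T assms(2) H_bil]
  have "frechet_derivative (\<lambda>x. G x b a) (at x) 0 = 0" "frechet_derivative (\<lambda>y. H y w u) (at y) 0 = 0"
    using linear_0[OF linear_frechet_derivative] G_diff[OF assms(1)] H_diff[OF assms(2)] by blast+
  then show "2 * K (x, y) (0, (frechet_derivative \<phi> (at x) b / (2 * \<phi> x)) *\<^sub>R w) q =
      frechet_derivative (\<lambda>z. K z (0, w) q) (at (x, y)) (b, 0)
      + frechet_derivative (\<lambda>z. K z (b, 0) q) (at (x, y)) (0, w)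
      - frechet_derivative (\<lambda>z. K z (b, 0) (0, w)) (at (x, y)) q"
    using \<phi>_nz[OF assms(1)]
    unfolding q frechet_derivative_K[OF assms] K_eq[OF assms]
    by (simp add: G0 H0 bilinear_lzero[OF G_bil[OF assms(1)]] bilinear_lzero[OF H_bil[OF assms(2)]]
        bilinear_lmul[OF H_bil[OF assms(2)]])
qed

text \<open>Where \<open>D\<phi> = 0\<close>, the mixed Christoffel symbols and the gradient part of the vertical ones vanish,
  but their derivatives in horizontal directions remain. Horizontal basis vectors thus contribute the
  trace of the derivative of the gradient, and vertical ones the Ricci curvature of the fibre.\<close>

lemma ricci_curv_vertical_critical:
  assumes x: "x \<in> S" and y: "y \<in> T" and crit: "frechet_derivative \<phi> (at x) = (\<lambda>v. 0)"
  shows "ricci_curv K (x, y) (0, v) (0, w) =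
    ricci_curv H y v w - H y v w / 2 * (\<Sum>b\<in>Basis. frechet_derivative (gradient G \<phi>) (at x) b \<bullet> b)"
proof -
  have ST: "open (S \<times> T)" "(x, y) \<in> S \<times> T"
    using open_S open_T x y by (auto simp: open_Times)
  have grad0: "gradient G \<phi> x = 0"
    by (rule gradient_eqI[of G, OF G_bil[OF x] G_nd[OF x]]) (simp add: crit bilinear_lzero[OF G_bil[OF x]])
  have H00: "H y v 0 = 0" "christoffel H y v 0 = 0" for v
  proof -
    show "H y v 0 = 0" by (rule bilinear_rzero[OF H_bil[OF y]])
    note H0 = frechet_derivative_form_zero[of T y H, OF open_T y H_bil]
    show "christoffel H y v 0 = 0"
      by (rule christoffel_eqI[of H, OF H_bil[OF y] H_nd[OF y]])
        (simp add: bilinear_lzero[OF H_bil[OF y]] H0 linear_0[OF linear_frechet_derivative[OF H_diff[OF y]]])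
  qed
  have fst: "(fst has_derivative fst) (at (x, y))" and snd: "(snd has_derivative snd) (at (x, y))"
    by (auto intro!: derivative_eq_intros)
  let ?D = "frechet_derivative (gradient G \<phi>) (at x)"
  have dgrad: "((\<lambda>z. gradient G \<phi> (fst z)) has_derivative (\<lambda>p. ?D (fst p))) (at (x, y))"
    using has_derivative_compose[OF fst, of "gradient G \<phi>"]
      has_derivative_frechet[OF differentiable_gradient[OF open_S x G_bil G_nd G_diff[OF x] \<phi>_diff \<phi>_diff2[OF x]]]
    by simp
  have dH: "((\<lambda>z. H (snd z) v w) has_derivative (\<lambda>p. frechet_derivative (\<lambda>y. H y v w) (at y) (snd p))) (at (x, y))" for v w
    using has_derivative_compose[OF snd, of "\<lambda>y. H y v w"] has_derivative_frechet[OF H_diff[OF y]] by simp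
  have dC: "((\<lambda>z. christoffel H (snd z) v w) has_derivative (\<lambda>p. frechet_derivative (\<lambda>y. christoffel H y v w) (at y) (snd p))) (at (x, y))" for v w
    using has_derivative_compose[OF snd, of "\<lambda>y. christoffel H y v w"]
      has_derivative_frechet[OF differentiable_christoffel[OF open_T y H_bil H_nd H_diff H_diff2[OF y]]] by simp
  have vert: "frechet_derivative (\<lambda>z. christoffel K z (0, v) (0, w)) (at (x, y)) (b, u) =
      (- (H y v w / 2) *\<^sub>R ?D b, frechet_derivative (\<lambda>y. christoffel H y v w) (at y) u)" for v w b u
  proof -
    have "frechet_derivative (\<lambda>z. christoffel K z (0, v) (0, w)) (at (x, y)) =
        frechet_derivative (\<lambda>z. (- (H (snd z) v w / 2) *\<^sub>R gradient G \<phi> (fst z), christoffel H (snd z) v w)) (at (x, y))"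
      by (rule frechet_derivative_cong_open[OF ST]) (auto simp: christoffel_vertical)
    moreover have "((\<lambda>z. (- (H (snd z) v w / 2) *\<^sub>R gradient G \<phi> (fst z), christoffel H (snd z) v w))
        has_derivative (\<lambda>p. (- (H y v w / 2) *\<^sub>R ?D (fst p), frechet_derivative (\<lambda>y. christoffel H y v w) (at y) (snd p)))) (at (x, y))"
      by (auto intro!: derivative_eq_intros dH dC dgrad simp: grad0)
    ultimately show ?thesis
      by (simp add: frechet_derivative_eqI)
  qed
  have mixed: "frechet_derivative (\<lambda>z. christoffel K z (b, 0) (0, w)) (at (x, y)) (0, v) = 0" for b w v
  proof -
    let ?c = "\<lambda>x. frechet_derivative \<phi> (at x) b / (2 * \<phi> x)"
    have "?c differentiable (at x)"
      using \<phi>_diff[OF x] \<phi>_diff2[OF x] \<phi>_nz[OF x] by (intro differentiable_divide differentiable_mult) auto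
    from has_derivative_compose[OF fst, of ?c, simplified fst_conv, OF has_derivative_frechet[OF this]]
    have "((\<lambda>z. (0::'e, ?c (fst z) *\<^sub>R w)) has_derivative (\<lambda>p. (0, frechet_derivative ?c (at x) (fst p) *\<^sub>R w))) (at (x, y))"
      by (intro has_derivative_Pair has_derivative_const has_derivative_scaleR_left)
    then have "frechet_derivative (\<lambda>z. (0::'e, ?c (fst z) *\<^sub>R w)) (at (x, y)) (0, v) = 0"
      using linear_0[OF linear_frechet_derivative[OF \<open>?c differentiable (at x)\<close>]]
      by (simp add: frechet_derivative_eqI zero_prod_def)
    moreover have "frechet_derivative (\<lambda>z. christoffel K z (b, 0) (0, w)) (at (x, y)) =
        frechet_derivative (\<lambda>z. (0, ?c (fst z) *\<^sub>R w)) (at (x, y))"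
      by (rule frechet_derivative_cong_open[OF ST]) (auto simp: christoffel_mixed)
    ultimately show ?thesis by simp
  qed
  have R1: "riemann_curv K (x, y) (b, 0) (0, v) (0, w) = (- (H y v w / 2) *\<^sub>R ?D b, 0)" for b
  proof -
    have "linear (frechet_derivative (\<lambda>y. christoffel H y v w) (at y))"
      using differentiable_christoffel[OF open_T y H_bil H_nd H_diff H_diff2[OF y]]
      by (rule linear_frechet_derivative)
    then have "frechet_derivative (\<lambda>y. christoffel H y v w) (at y) 0 = 0"
      by (rule linear_0)
    then show ?thesis
      unfolding riemann_curv_def vert mixed christoffel_vertical[OF x y] christoffel_mixed[OF x y]
      by (simp add: grad0 crit christoffel_mixed[OF x y] christoffel_vertical[OF x y] H00 zero_prod_def[symmetric])
  qed
  have R2: "riemann_curv K (x, y) (0, b) (0, v) (0, w) = (0, riemann_curv H y b v w)" for b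
  proof -
    have "linear ?D"
      by (rule linear_frechet_derivative[OF differentiable_gradient[OF open_S x G_bil G_nd G_diff[OF x] \<phi>_diff \<phi>_diff2[OF x]]])
    then have "?D 0 = 0"
      by (rule linear_0)
    then show ?thesis
      unfolding riemann_curv_def vert christoffel_vertical[OF x y]
      by (simp add: grad0 christoffel_vertical[OF x y])
  qed
  show ?thesis
    unfolding ricci_curv_def sum_Basis_prod
    by (simp add: R1 R2 sum_distrib_left sum_negf)
qed

end

section \<open>Coordinates on the product manifold\<close>

lemma chart_inv_in_dom: "x \<in> chart_range c \<Longrightarrow> chart_inv c x \<in> chart_dom c"
  and chart_map_inv: "x \<in> chart_range c \<Longrightarrow> chart_map c (chart_inv c x) = x"
  by (auto simp: chart_range_def chart_inv_def inv_into_into f_inv_into_f)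

lemma chart_inv_map:
  "inj_on (chart_map c) (chart_dom c) \<Longrightarrow> p \<in> chart_dom c \<Longrightarrow> chart_inv c (chart_map c p) = p"
  by (simp add: chart_inv_def)

lemma chart_range_prod: "chart_range (prod_chart c d) = chart_range c \<times> chart_range d"
  by (force simp: chart_range_def prod_chart_def)

lemma chart_inv_prod:
  assumes "inj_on (chart_map c) (chart_dom c)" "inj_on (chart_map d) (chart_dom d)"
    and "x \<in> chart_range c" "y \<in> chart_range d"
  shows "chart_inv (prod_chart c d) (x, y) = (chart_inv c x, chart_inv d y)"
  unfolding chart_inv_def[of "prod_chart c d"]
proof (rule inv_into_f_eq)
  show "inj_on (chart_map (prod_chart c d)) (chart_dom (prod_chart c d))"
    using assms(1,2) by (auto simp: prod_chart_def inj_on_def)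
qed (simp_all add: prod_chart_def chart_inv_in_dom chart_map_inv assms)

lemma smooth_atlas_chart:
  assumes "smooth_atlas X A" "c \<in> A"
  shows "openin X (chart_dom c)" "open (chart_range c)" "inj_on (chart_map c) (chart_dom c)"
    and "continuous_map (subtopology X (chart_dom c)) (top_of_set (chart_range c)) (chart_map c)"
proof -
  have h: "homeomorphic_map (subtopology X (chart_dom c)) (top_of_set (chart_range c)) (chart_map c)"
    and o: "openin X (chart_dom c)" "open (chart_range c)"
    using assms by (auto simp: smooth_atlas_def)
  then show "openin X (chart_dom c)" "open (chart_range c)" by blast+
  show "continuous_map (subtopology X (chart_dom c)) (top_of_set (chart_range c)) (chart_map c)"
    using h by (rule homeomorphic_imp_continuous_map)
  show "inj_on (chart_map c) (chart_dom c)"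
    using homeomorphic_imp_injective_map[OF h] openin_subset[OF o(1)] by (simp add: Int_absorb1)
qed

lemma smooth_atlas_cover:
  assumes "smooth_atlas X A" "p \<in> topspace X"
  obtains c where "c \<in> A" "p \<in> chart_dom c"
proof -
  have "p \<in> (\<Union>c\<in>A. chart_dom c)"
    using assms by (simp add: smooth_atlas_def)
  then show ?thesis
    using that by blast
qed

text \<open>Composition with \<open>\<pi>\<close> preserves smoothness; for the converse, composition with the affine section
  \<open>x \<mapsto> L x + k\<close> of \<open>\<pi>\<close> recovers \<open>F'\<close> from its pullback.\<close>

lemma smooth_near_pullback:
  fixes \<pi> :: "'x::euclidean_space \<Rightarrow> 'e::euclidean_space"
  assumes \<pi>: "linear \<pi>" and L: "linear L" "\<And>x. \<pi> (L x + k) = x" "L (\<pi> z) + k = z"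
    and R: "open R" "z \<in> R" "\<pi> ` R \<subseteq> R'" "open R'" and F: "\<And>z. z \<in> R \<Longrightarrow> F z = F' (\<pi> z)"
  shows "(\<exists>W. open W \<and> z \<in> W \<and> W \<subseteq> R \<and> smooth_on W F) \<longleftrightarrow>
    (\<exists>W. open W \<and> \<pi> z \<in> W \<and> W \<subseteq> R' \<and> smooth_on W F')"
proof
  have aff: "continuous_on UNIV (\<lambda>x. L x + k)"
    using L(1) by (intro continuous_intros linear_continuous_on) (simp add: linear_linear)
  assume "\<exists>W. open W \<and> z \<in> W \<and> W \<subseteq> R \<and> smooth_on W F"
  then obtain W where W: "open W" "z \<in> W" "W \<subseteq> R" "smooth_on W F" by blast
  let ?V = "(\<lambda>x. L x + k) -` W"
  have V: "open ?V"
    using W(1) aff by (simp add: open_vimage)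
  have "smooth_on ?V F'"
    unfolding smooth_on_def
  proof
    fix n
    have "Ck_on n ?V (\<lambda>x. F (L x + k))"
      using Ck_on_compose_affine[OF W(1) L(1), of n F k] W(4) by (simp add: smooth_on_def)
    moreover have "F (L x + k) = F' x" if "x \<in> ?V" for x
      using F[of "L x + k"] L(2)[of x] W(3) that by auto
    ultimately show "Ck_on n ?V F'"
      using Ck_on_cong[OF V, of "\<lambda>x. F (L x + k)" F' n] by simp
  qed
  moreover have "?V \<subseteq> R'"
  proof
    fix x assume "x \<in> ?V"
    then have "L x + k \<in> R" using W(3) by auto
    then have "\<pi> (L x + k) \<in> R'" using R(3) by blast
    then show "x \<in> R'" using L(2) by simp
  qed
  ultimately show "\<exists>W. open W \<and> \<pi> z \<in> W \<and> W \<subseteq> R' \<and> smooth_on W F'"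
    using V W(2) L(3) by (intro exI[of _ ?V]) auto
next
  assume "\<exists>W. open W \<and> \<pi> z \<in> W \<and> W \<subseteq> R' \<and> smooth_on W F'"
  then obtain W where W: "open W" "\<pi> z \<in> W" "W \<subseteq> R'" "smooth_on W F'" by blast
  have "continuous_on UNIV \<pi>"
    using \<pi> by (intro linear_continuous_on) (simp add: linear_linear)
  then have V: "open (\<pi> -` W \<inter> R)"
    using W(1) R(1) by (simp add: open_vimage open_Int)
  have "smooth_on (\<pi> -` W \<inter> R) F"
    unfolding smooth_on_def
  proof
    fix n
    have "Ck_on n (\<pi> -` W) (\<lambda>x. F' (\<pi> x))"
      using Ck_on_compose_affine[OF W(1) \<pi>, of n F' 0] W(4) by (simp add: smooth_on_def)
    then have "Ck_on n (\<pi> -` W \<inter> R) (\<lambda>x. F' (\<pi> x))"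
      by (rule Ck_on_subset) simp
    then show "Ck_on n (\<pi> -` W \<inter> R) F"
      using Ck_on_cong[OF V, of F "\<lambda>x. F' (\<pi> x)" n] F by simp
  qed
  then show "\<exists>W. open W \<and> z \<in> W \<and> W \<subseteq> R \<and> smooth_on W F"
    using V W(2) R(2) by (intro exI[of _ "\<pi> -` W \<inter> R"]) auto
qed

lemma frechet_derivative_pullback:
  fixes \<pi> :: "'x::euclidean_space \<Rightarrow> 'e::euclidean_space"
  assumes "linear \<pi>" "open R" "z \<in> R" "\<And>z. z \<in> R \<Longrightarrow> F z = F' (\<pi> z)" "F' differentiable (at (\<pi> z))"
  shows "frechet_derivative F (at z) v = frechet_derivative F' (at (\<pi> z)) (\<pi> v)"
proof -
  have "frechet_derivative F (at z) = frechet_derivative (\<lambda>z. F' (\<pi> z)) (at z)"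
    by (rule frechet_derivative_cong_open[OF assms(2-4)])
  also have "\<dots> = (\<lambda>v. frechet_derivative F' (at (\<pi> z)) (\<pi> v))"
    using has_derivative_compose[OF linear_imp_has_derivative[OF assms(1)] has_derivative_frechet[OF assms(5)]]
    by (rule frechet_derivative_eqI)
  finally show ?thesis by simp
qed

lemma smooth_on_differentiable:
  assumes "smooth_on S F" "x \<in> S"
  shows "F differentiable (at x)" "(\<lambda>x. frechet_derivative F (at x) v) differentiable (at x)"
proof -
  have "Ck_on (Suc (Suc 0)) S F"
    using assms(1) unfolding smooth_on_def by blast
  then show "F differentiable (at x)" "(\<lambda>x. frechet_derivative F (at x) v) differentiable (at x)"
    using assms(2) by auto
qed

text \<open>A coordinate vector is \<open>0\<close> on functions that are not smooth near its base point, so besides the chain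
  rule this uses that a function is smooth near a point exactly if its pullback to the product is.\<close>

lemma pushforward_coord_vec_prod:
  fixes c :: "('a, 'c::euclidean_space) chart" and d :: "('b, 'd::euclidean_space) chart"
  assumes inj: "inj_on (chart_map c) (chart_dom c)" "inj_on (chart_map d) (chart_dom d)"
    and op: "open (chart_range c)" "open (chart_range d)"
    and pq: "p \<in> chart_dom c" "q \<in> chart_dom d"
  shows "pushforward fst (coord_vec (prod_chart c d) (p, q) v) = coord_vec c p (fst v)" (is ?fst)
    and "pushforward snd (coord_vec (prod_chart c d) (p, q) v) = coord_vec d q (snd v)" (is ?snd)
proof -
  let ?x = "chart_map c p" and ?y = "chart_map d q" and ?R = "chart_range c \<times> chart_range d"
  have R: "open ?R" "(?x, ?y) \<in> ?R"
    using op pq by (auto simp: open_Times chart_range_def)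
  have m: "chart_map (prod_chart c d) (p, q) = (?x, ?y)"
    by (simp add: prod_chart_def)
  have lin: "linear (fst :: 'c \<times> 'd \<Rightarrow> 'c)" "linear (snd :: 'c \<times> 'd \<Rightarrow> 'd)"
    "linear (\<lambda>x::'c. (x, 0::'d))" "linear (\<lambda>y::'d. (0::'c, y))"
    by (auto intro!: linearI)
  show ?fst
  proof
    fix k :: "'a \<Rightarrow> real"
    let ?F = "(k \<circ> fst) \<circ> chart_inv (prod_chart c d)" and ?F' = "k \<circ> chart_inv c"
    have F: "?F z = ?F' (fst z)" if "z \<in> ?R" for z
      using that by (cases z) (simp add: chart_inv_prod[OF inj])
    have "smooth_near (prod_chart c d) (p, q) (k \<circ> fst) \<longleftrightarrow> smooth_near c p k"
      unfolding smooth_near_def chart_range_prod m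
      using smooth_near_pullback[OF lin(1,3), of "(0, ?y)" "(?x, ?y)" ?R "chart_range c" ?F ?F'] R op F
      by auto
    moreover have "frechet_derivative ?F (at (?x, ?y)) v = frechet_derivative ?F' (at ?x) (fst v)"
      if "smooth_near c p k"
      using frechet_derivative_pullback[of fst ?R _ ?F ?F', OF lin(1) R F, simplified fst_conv] that
        smooth_on_differentiable(1)
      unfolding smooth_near_def by blast
    ultimately show "pushforward fst (coord_vec (prod_chart c d) (p, q) v) k = coord_vec c p (fst v) k"
      by (simp add: pushforward_def coord_vec_def m)
  qed
  show ?snd
  proof
    fix k :: "'b \<Rightarrow> real"
    let ?F = "(k \<circ> snd) \<circ> chart_inv (prod_chart c d)" and ?F' = "k \<circ> chart_inv d"
    have F: "?F z = ?F' (snd z)" if "z \<in> ?R" for z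
      using that by (cases z) (simp add: chart_inv_prod[OF inj])
    have "smooth_near (prod_chart c d) (p, q) (k \<circ> snd) \<longleftrightarrow> smooth_near d q k"
      unfolding smooth_near_def chart_range_prod m
      using smooth_near_pullback[OF lin(2,4), of "(?x, 0)" "(?x, ?y)" ?R "chart_range d" ?F ?F'] R op F
      by auto
    moreover have "frechet_derivative ?F (at (?x, ?y)) v = frechet_derivative ?F' (at ?y) (snd v)"
      if "smooth_near d q k"
      using frechet_derivative_pullback[of snd ?R _ ?F ?F', OF lin(2) R F, simplified snd_conv] that
        smooth_on_differentiable(1)
      unfolding smooth_near_def by blast
    ultimately show "pushforward snd (coord_vec (prod_chart c d) (p, q) v) k = coord_vec d q (snd v) k"
      by (simp add: pushforward_def coord_vec_def m)
  qed
qed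

lemma coord_expr_warped_metric:
  assumes inj: "inj_on (chart_map c) (chart_dom c)" "inj_on (chart_map d) (chart_dom d)"
    and op: "open (chart_range c)" "open (chart_range d)"
    and xy: "x \<in> chart_range c" "y \<in> chart_range d"
  shows "coord_expr (warped_metric g f h) (prod_chart c d) (x, y) (a, v) (a', w) =
    coord_expr g c x a a' + (f (chart_inv c x))\<^sup>2 * coord_expr h d y v w"
  unfolding coord_expr_def chart_inv_prod[OF inj xy] warped_metric_def
    pushforward_coord_vec_prod[OF inj op chart_inv_in_dom[OF xy(1)] chart_inv_in_dom[OF xy(2)]]
  by simp

lemma smooth_fun_continuous_map:
  assumes A: "smooth_atlas X A" and f: "smooth_fun A f"
  shows "continuous_map X euclideanreal f"
proof (rule pasting_lemma[where I = A and T = chart_dom and f = "\<lambda>_. f"])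
  fix c assume c: "c \<in> A"
  show "openin X (chart_dom c)"
    by (rule smooth_atlas_chart(1)[OF A c])
  have "Ck_on 0 (chart_range c) (f \<circ> chart_inv c)"
    using f c unfolding smooth_fun_def smooth_on_def by blast
  then have "continuous_map (top_of_set (chart_range c)) euclideanreal (f \<circ> chart_inv c)"
    by simp
  with smooth_atlas_chart(4)[OF A c]
  have "continuous_map (subtopology X (chart_dom c)) euclideanreal ((f \<circ> chart_inv c) \<circ> chart_map c)"
    by (rule continuous_map_compose)
  then show "continuous_map (subtopology X (chart_dom c)) euclideanreal f"
    by (rule continuous_map_eq) (simp add: chart_inv_map[OF smooth_atlas_chart(3)[OF A c]])
next
  show "\<exists>c. c \<in> A \<and> p \<in> chart_dom c \<and> f p = f p" if "p \<in> topspace X" for p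
    using smooth_atlas_cover[OF A that] by metis
qed auto

section \<open>Extrema of the warping function\<close>

text \<open>The sign \<open>s\<close> is \<open>1\<close> at a maximum and \<open>-1\<close> at a minimum of \<open>f\<close>. With \<open>\<phi> = f\<^sup>2\<close>, a vertical component of
  the Einstein equation for which \<open>h\<close> does not vanish says that the trace of \<open>D(grad \<phi>)\<close> is
  \<open>- 2 * lam * \<phi>\<close>, and \<open>s\<close> times this trace is nonpositive.\<close>

lemma einstein_warped_extremum:
  fixes A :: "('a, 'e::euclidean_space) chart set" and B :: "('b, 'f::euclidean_space) chart set"
  assumes A: "smooth_atlas X A" "riemannian_metric A g"
    and B: "smooth_atlas Y B" "semi_riemannian_metric B h" "ricci_flat B h"
    and f: "smooth_fun A f" "\<forall>p\<in>topspace X. 0 < f p"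
    and E: "einstein_metric (prod_atlas A B) (warped_metric g f h) lam"
    and p: "p \<in> topspace X" and Y: "topspace Y \<noteq> {}"
    and s: "s = 1 \<or> s = -1" and extr: "\<And>q. q \<in> topspace X \<Longrightarrow> s * f q \<le> s * f p"
  shows "0 \<le> s * lam"
proof -
  obtain c where c: "c \<in> A" "p \<in> chart_dom c"
    by (rule smooth_atlas_cover[OF A(1) p])
  obtain d q where d: "d \<in> B" "q \<in> chart_dom d"
    using smooth_atlas_cover[OF B(1)] Y by (metis all_not_in_conv)
  note C = smooth_atlas_chart[OF A(1) c(1)] and D = smooth_atlas_chart[OF B(1) d(1)]
  define S where "S = chart_range c"
  define T where "T = chart_range d"
  define G where "G = coord_expr g c"
  define H where "H = coord_expr h d"
  define F where "F = f \<circ> chart_inv c"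
  define \<phi> where "\<phi> x = (F x)\<^sup>2" for x
  define K where "K = coord_expr (warped_metric g f h) (prod_chart c d)"
  define x where "x = chart_map c p"
  define y where "y = chart_map d q"
  have x: "x \<in> S" and y: "y \<in> T"
    using c d by (auto simp: x_def y_def S_def T_def chart_range_def)
  have Fx: "F x = f p"
    using chart_inv_map[OF C(3) c(2)] by (simp add: F_def x_def)
  have in_X: "chart_inv c z \<in> topspace X" if "z \<in> S" for z
    using chart_inv_in_dom[of z c] that openin_subset[OF C(1)] by (auto simp: S_def)
  have F_pos: "0 < F z" if "z \<in> S" for z
    using f(2) in_X[OF that] by (simp add: F_def)
  have F_smooth: "smooth_on S F"
    using f(1) c(1) by (simp add: smooth_fun_def S_def F_def)
  note dF = smooth_on_differentiable[OF F_smooth]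
  have d\<phi>: "\<phi> differentiable (at z)" "frechet_derivative \<phi> (at z) v = 2 * F z * frechet_derivative F (at z) v"
    if "z \<in> S" for z v
  proof -
    have "(\<phi> has_derivative (\<lambda>v. 2 * F z * frechet_derivative F (at z) v)) (at z)"
      unfolding \<phi>_def[abs_def]
      by (auto intro!: derivative_eq_intros has_derivative_frechet[OF dF(1)[OF that]])
    then show "\<phi> differentiable (at z)" "frechet_derivative \<phi> (at z) v = 2 * F z * frechet_derivative F (at z) v"
      by (auto simp: differentiable_def frechet_derivative_eqI)
  qed
  have open_S: "open S" and open_T: "open T"
    using C(2) D(2) by (auto simp: S_def T_def)
  have d2\<phi>: "(\<lambda>z. frechet_derivative \<phi> (at z) v) differentiable (at z)" if "z \<in> S" for z v
  proof -
    have "(\<lambda>z. 2 * F z * frechet_derivative F (at z) v) differentiable (at z)"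
      using dF[OF that] by (intro differentiable_mult) auto
    then show ?thesis
      by (rule differentiable_cong_open[OF open_S that, THEN iffD2, rotated]) (rule d\<phi>(2))
  qed
  have A': "semi_riemannian_metric A g" and G_pos: "\<And>z v. z \<in> S \<Longrightarrow> v \<noteq> 0 \<Longrightarrow> 0 < G z v v"
    using A(2) c(1) by (auto simp: riemannian_metric_def S_def G_def)
  have G: "smooth_on S (\<lambda>z. G z v w)" "z \<in> S \<Longrightarrow> bilinear (G z)" "z \<in> S \<Longrightarrow> G z v w = G z w v"
    "z \<in> S \<Longrightarrow> nondegenerate (G z)" for z v w
    using A' c(1) unfolding semi_riemannian_metric_def nondegenerate_def S_def G_def by blast+
  have H: "smooth_on T (\<lambda>z. H z v w)" "z \<in> T \<Longrightarrow> bilinear (H z)" "z \<in> T \<Longrightarrow> nondegenerate (H z)" for z v w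
    using B(2) d(1) unfolding semi_riemannian_metric_def nondegenerate_def T_def H_def by blast+
  have crit: "frechet_derivative \<phi> (at x) = (\<lambda>v. 0)"
    and hess: "s * frechet_derivative (\<lambda>z. frechet_derivative \<phi> (at z) v) (at x) v \<le> 0" for v
  proof -
    have ds\<phi>: "frechet_derivative (\<lambda>z. s * \<phi> z) (at z) = (\<lambda>v. s * frechet_derivative \<phi> (at z) v)"
      if "z \<in> S" for z
      by (rule frechet_derivative_eqI[OF has_derivative_mult_right[OF has_derivative_frechet[OF d\<phi>(1)[OF that]]]])
    have sd: "(\<lambda>z. s * \<phi> z) differentiable (at z)" if "z \<in> S" for z
      using d\<phi>(1)[OF that] by (intro differentiable_mult) auto
    have sd2: "(\<lambda>z. frechet_derivative (\<lambda>z. s * \<phi> z) (at z) v) differentiable (at x)" for v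
    proof -
      have "(\<lambda>z. s * frechet_derivative \<phi> (at z) v) differentiable (at x)"
        using d2\<phi>[OF x] by (intro differentiable_mult) auto
      then show ?thesis
        using differentiable_cong_open[OF open_S x] ds\<phi> by (metis (no_types, lifting))
    qed
    \<comment> \<open>Squaring is monotone on the positive values of \<open>F\<close>, so \<open>\<phi>\<close> has the same extrema.\<close>
    have max: "s * \<phi> z \<le> s * \<phi> x" if "z \<in> S" for z
    proof -
      have "s * F z \<le> s * F x"
        using extr[OF in_X[OF that]] Fx by (simp add: F_def)
      then show ?thesis
        using s F_pos[OF that] F_pos[OF x] by (auto simp: \<phi>_def intro: power_mono)
    qed
    note * = frechet_second_derivative_local_max[of S x "\<lambda>z. s * \<phi> z", OF open_S x sd sd2 max]
    show "frechet_derivative \<phi> (at x) = (\<lambda>v. 0)"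
      using *(1) ds\<phi>[OF x] s by (auto simp: fun_eq_iff)
    have "frechet_derivative (\<lambda>z. frechet_derivative (\<lambda>z. s * \<phi> z) (at z) v) (at x) =
        frechet_derivative (\<lambda>z. s * frechet_derivative \<phi> (at z) v) (at x)"
      by (rule frechet_derivative_cong_open[OF open_S x]) (simp add: ds\<phi>)
    also have "\<dots> = (\<lambda>u. s * frechet_derivative (\<lambda>z. frechet_derivative \<phi> (at z) v) (at x) u)"
      by (rule frechet_derivative_eqI[OF has_derivative_mult_right[OF has_derivative_frechet[OF d2\<phi>[OF x]]]])
    finally show "s * frechet_derivative (\<lambda>z. frechet_derivative \<phi> (at z) v) (at x) v \<le> 0"
      using *(2)[of v] by simp
  qed
  interpret warped_coordinates S T G H \<phi> K
  proof
    show "K (x, y) (a, v) (a', w) = G x a a' + \<phi> x * H y v w" if "x \<in> S" "y \<in> T" for x y a v a' w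
      using coord_expr_warped_metric[OF C(3) D(3) C(2) D(2)] that
      by (simp add: K_def G_def H_def \<phi>_def F_def S_def T_def)
    show "\<phi> x \<noteq> 0" if "x \<in> S" for x
      using F_pos[OF that] by (simp add: \<phi>_def)
  qed (use open_S open_T G H d\<phi>(1) d2\<phi> smooth_on_differentiable[OF G(1)] smooth_on_differentiable[OF H(1)] in auto)
  let ?L = "frechet_derivative (gradient G \<phi>) (at x)"
  let ?tr = "\<Sum>b\<in>Basis. ?L b \<bullet> b"
  have L: "G x (?L v) w = frechet_derivative (\<lambda>z. frechet_derivative \<phi> (at z) w) (at x) v" for v w
    by (rule derivative_gradient_critical[OF open_S x G_bil G_nd G_diff[OF x] \<phi>_diff \<phi>_diff2[OF x] crit])
  have "linear ?L"
    by (rule linear_frechet_derivative[OF differentiable_gradient[OF open_S x G_bil G_nd G_diff[OF x] \<phi>_diff \<phi>_diff2[OF x]]])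
  then have "(\<Sum>b\<in>Basis. (s *\<^sub>R ?L b) \<bullet> b) \<le> 0"
    using hess L
    by (intro trace_nonpos[of "G x"] linear_compose_scale_right G_bil[OF x] G(3)[OF x] G_pos[OF x])
      (auto simp: bilinear_lmul[OF G_bil[OF x]])
  then have tr: "s * ?tr \<le> 0"
    by (simp add: sum_distrib_left)
  obtain v w where vw: "H y v w \<noteq> 0"
    using H_nd[OF y] nonzero_Basis[OF SOME_Basis] unfolding nondegenerate_def by blast
  have "prod_chart c d \<in> prod_atlas A B"
    using c(1) d(1) unfolding prod_atlas_def by blast
  moreover have "(x, y) \<in> chart_range (prod_chart c d)"
    using x y by (simp add: chart_range_prod S_def T_def)
  ultimately have "ricci_curv K (x, y) (0, v) (0, w) = lam * K (x, y) (0, v) (0, w)"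
    using E by (simp add: einstein_metric_def K_def)
  moreover have "ricci_curv H y v w = 0"
    using B(3) d(1) y by (simp add: ricci_flat_def H_def T_def)
  ultimately have "- (H y v w / 2 * ?tr) = lam * (\<phi> x * H y v w)"
    using ricci_curv_vertical_critical[OF x y crit, of v w] K_eq[OF x y] bilinear_lzero[OF G_bil[OF x]]
    by simp
  then have "H y v w * (?tr + 2 * lam * \<phi> x) = 0"
    by (simp add: algebra_simps)
  then have "?tr = - 2 * lam * \<phi> x"
    using vw by simp
  then have "0 \<le> s * lam * \<phi> x"
    using tr by (simp add: algebra_simps)
  moreover have "0 < \<phi> x"
    using F_pos[OF x] by (simp add: \<phi>_def)
  ultimately show ?thesis
    by (simp add: zero_le_mult_iff)
qed

theorem theorem1:
  fixes X :: "'a topology" and A :: "('a, 'e::euclidean_space) chart set" and g :: "'a tensor2"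
    and Y :: "'b topology" and B :: "('b, 'f::euclidean_space) chart set" and h :: "'b tensor2"
    and f :: "'a \<Rightarrow> real" and lam :: real
  assumes "DIM('e) \<ge> 3" and "DIM('f) \<ge> 2"
    and "smooth_manifold X A" and "compact_space X" and "riemannian_metric A g"
    and "smooth_manifold Y B" and "semi_riemannian_metric B h" and "ricci_flat B h"
    and "smooth_fun A f" and "\<forall>p\<in>topspace X. 0 < f p"
    and "einstein_metric (prod_atlas A B) (warped_metric g f h) lam" and "lam \<noteq> 0"
  shows "f constant_on topspace X"
proof -
  have X: "smooth_atlas X A" "topspace X \<noteq> {}" and Y: "smooth_atlas Y B" "topspace Y \<noteq> {}"
    using assms by (auto simp: smooth_manifold_def)
  have "compactin euclideanreal (f ` topspace X)"
    using assms(4) smooth_fun_continuous_map[OF X(1) assms(9)]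
    by (intro image_compactin[of X]) (auto simp: compact_space_def)
  then have cpt: "compact (f ` topspace X)"
    by simp
  obtain p where p: "p \<in> topspace X" "\<And>q. q \<in> topspace X \<Longrightarrow> f q \<le> f p"
    using compact_attains_sup[OF cpt] X(2) by auto
  obtain p' where p': "p' \<in> topspace X" "\<And>q. q \<in> topspace X \<Longrightarrow> f p' \<le> f q"
    using compact_attains_inf[OF cpt] X(2) by auto
  note extr = einstein_warped_extremum[OF X(1) assms(5) Y(1) assms(7-11) _ Y(2)]
  have "0 \<le> lam"
    using extr[of p 1] p by simp
  moreover have "lam \<le> 0"
    using extr[of p' "-1"] p' by simp
  ultimately show ?thesis
    using assms(12) by simp
qed

end
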